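(* Let $F$ be a continuous distribution function on $\mathbb{R}$, let $\{\alpha_n\}_{n\ge1}$ be a positive sequence such that $s_n:=\sum_{k=1}^n\alpha_k\to\infty$ as $n\to\infty$, let $\{\mathcal{X}_n\}_{n\ge1}$ be independent random variables such that $\mathcal{X}_n$ has distribution function $F^{\alpha_n}$, $n\ge1$, and let $\mathcal{M}_n:=\max_{1\le k\le n}\mathcal{X}_k$. Let $\{\ell_n\}_{n\ge1}$ be a non-decreasing real sequence and put $q_n:=1-F(\ell_n)$. Then: (i) One always has $\mathbf{P}(\mathcal{M}_n>\ell_n\ \text{ev.})=0$ or $1$. (ii) If $q_n\to c>0$ as $n\to\infty$, then $\mathbf{P}(\mathcal{M}_n>\ell_n\ \text{ev.})=1$. (iii) If $\lim_{n\to\infty}q_n=0$ and $\liminf_{n\to\infty}s_nq_n<\infty$, then $\mathbf{P}(\mathcal{M}_n>\ell_n\ \text{ev.})=0$. (iv) If $\lim_{n\to\infty}q_n=0$ and $\lim_{n\to\infty}s_nq_n=\infty$, then $$\mathbf{P}(\mathcal{M}_n>\ell_n\ \text{ev.})=\begin{cases}0 & \text{if } K(\ell)=\infty,\\ 1 & \text{if } K(\ell)<\infty,\end{cases}\qquad\text{where } K(\ell):=\sum_{n\ge1}e^{-s_nq_n}\bigl(1-e^{-\alpha_{n+1}q_n}\bigr).$$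
   Context: $\{\mathcal{M}_n>\ell_n\ \text{ev.}\}$ denotes the event that $\mathcal{M}_n>\ell_n$ for all sufficiently large $n$ ("eventually"). *)

theory Defs
  imports "HOL-Probability.Probability"
begin

text \<open>
  All sequences are indexed by \<open>n \<ge> 1\<close>; their value at index 0 is never used.
\<close>

definition partial_sum :: "(nat \<Rightarrow> real) \<Rightarrow> nat \<Rightarrow> real" where
  "partial_sum \<alpha> n = (\<Sum>k = 1..n. \<alpha> k)"

definition running_max :: "(nat \<Rightarrow> 'a \<Rightarrow> real) \<Rightarrow> nat \<Rightarrow> 'a \<Rightarrow> real" where
  "running_max X n \<omega> = Max ((\<lambda>k. X k \<omega>) ` {1..n})"

definition tail_seq :: "(real \<Rightarrow> real) \<Rightarrow> (nat \<Rightarrow> real) \<Rightarrow> nat \<Rightarrow> real" where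
  "tail_seq F l n = 1 - F (l n)"

definition ev_above :: "'a measure \<Rightarrow> (nat \<Rightarrow> 'a \<Rightarrow> real) \<Rightarrow> (nat \<Rightarrow> real) \<Rightarrow> 'a set" where
  "ev_above P X l = {\<omega> \<in> space P. \<forall>\<^sub>F n in sequentially. running_max X n \<omega> > l n}"

text \<open>
  The series is over \<open>n \<ge> 1\<close>, hence the shift by \<open>Suc\<close>. For \<open>q \<ge> 0\<close> and \<open>\<alpha> > 0\<close> (on positive
  indices) its terms are nonnegative, so \<open>ennreal\<close> truncates nothing.
\<close>

definition K_series :: "(nat \<Rightarrow> real) \<Rightarrow> (nat \<Rightarrow> real) \<Rightarrow> ennreal" where
  "K_series \<alpha> q = (\<Sum>i. let n = Suc i in
     ennreal (exp (- (partial_sum \<alpha> n * q n)) * (1 - exp (- (\<alpha> (n + 1) * q n)))))"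

end

theory Submission
  imports Defs
begin

text \<open>
  Write \<open>r n = - ln (F (l n))\<close>, so that the maximum of the first \<open>n\<close> variables is at most \<open>l n\<close>
  with probability \<open>F (l n) powr s n = exp (- (s n * r n))\<close>. The question is whether these events
  \<open>B n\<close> recur. For small \<open>q n\<close> the numbers \<open>r n\<close> and \<open>q n\<close> are comparable, and the \<open>n\<close>-th term of
  the series is comparable to the probability of an exit from below the level,
  \<open>exp (- (s n * r n)) * (1 - exp (- (\<alpha> (n + 1) * r n)))\<close>, except at indices whose total
  contribution is finite anyway (\<open>recurrence_series_diverges\<close>).

  The easy cases are these. If \<open>q\<close> has a positive limit, the levels stay below some \<open>L\<close> with
  \<open>F L < 1\<close>, which the maximum exceeds sooner or later. If \<open>q\<close> tends to \<open>0\<close>, changing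
  finitely many variables changes the event by a null set only, so Kolmogorov's zero-one law holds
  (\<open>ev_above_zero_one\<close>). If moreover \<open>s n * q n\<close> is bounded along a subsequence, the probabilities of \<open>B n\<close> are bounded away
  from \<open>0\<close> along it. If the series converges, Borel--Cantelli leaves finitely many exits, and since
  the levels are non-decreasing a path without further exits would stay below them for ever
  (\<open>prob_ev_above_eq_1_if_summable\<close>).

  The main difficulty is the divergent case. The zero-one law reduces it to recurrence with positive
  probability, which a second moment bound of Kochen--Stone type provides
  (\<open>prob_tail_Union_ge_kochen_stone\<close>), once
  the conditional probabilities \<open>exp (- ((s j - s k) * r j))\<close> of \<open>B j\<close> given \<open>B k\<close> sum up to at most a
  constant plus a multiple of the sum of the probabilities of \<open>B j\<close>. This can fail for the full
  sequence for two reasons, and each is cured by passing to a subsequence. Neighbouring \<open>B n\<close> are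
  nearly the same event: measuring time by the sums of \<open>1 - exp (- (\<alpha> (n + 1) * r n))\<close> and taking
  the most probable \<open>B n\<close> in each unit of time keeps the series divergent and separates the events
  (\<open>separated_peaks_exist\<close>). And \<open>r\<close> may drop steeply after time \<open>k\<close>, which makes \<open>B j\<close> likely
  after \<open>B k\<close> for many \<open>j\<close>; but then some later event is much more probable than \<open>B k\<close> itself, so such
  \<open>k\<close> can be discarded by charging them to a later peak (\<open>not_summable_peaks\<close>). For the indices that
  remain, the correlation bound is \<open>sum_conditional_le\<close>.
\<close>

section \<open>Elementary estimates and peaks of divergent series\<close>

text \<open>
  Sums of relative increments of a positive non-decreasing sequence, each divided by the current
  value, converge: this is a discrete form of \<open>\<integral> dx / x\<^sup>2 < \<infinity>\<close>. The truncation at \<open>1\<close> keeps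
  the comparison valid when the sequence makes large jumps.
\<close>
lemma relative_increment_le_telescope:
  fixes x y :: real
  assumes "0 < x" "x \<le> y"
  shows "min 1 ((y - x) / x) / x \<le> 2 * (1 / x - 1 / y)"
proof (cases "y \<le> 2 * x")
  case True
  have "min 1 ((y - x) / x) / x \<le> (y - x) / x / x"
    using assms by (intro divide_right_mono) auto
  also have "\<dots> \<le> 2 * (1 / x - 1 / y)"
  proof -
    have "(y - x) / x / x = ((y - x) * y) / (x * x * y)" using assms by simp
    also have "\<dots> \<le> ((y - x) * (2 * x)) / (x * x * y)"
      using True assms by (intro divide_right_mono mult_left_mono) auto
    also have "\<dots> = 2 * (1 / x - 1 / y)" using assms by (simp add: field_simps)
    finally show ?thesis .
  qed
  finally show ?thesis .
next
  case False
  have "min 1 ((y - x) / x) / x \<le> 1 / x"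
    using assms by (intro divide_right_mono) auto
  also have "\<dots> \<le> 2 * (1 / x - 1 / y)"
    using assms False by (simp add: field_simps)
  finally show ?thesis .
qed

lemma exp_minus_le_inverse_square:
  fixes x :: real
  assumes "0 < x"
  shows "exp (- x) \<le> 2 / x\<^sup>2"
proof -
  have "x\<^sup>2 / 2 \<le> exp x"
    using exp_lower_Taylor_quadratic[of x] assms by linarith
  then show ?thesis
    using assms by (simp add: exp_minus field_simps)
qed

lemma sum_telescope_two_steps_le:
  fixes a :: "nat \<Rightarrow> real"
  assumes nn: "\<And>n. 0 \<le> a n" and dec: "\<And>n. a (Suc n) \<le> a n"
  shows "(\<Sum>j\<in>{k<..n}. a j - a (j + 2)) \<le> 2 * a k"
proof -
  have *: "(\<Sum>j\<in>{k<..k+d}. a j - a (j + 2)) = a (k+1) + a (k+2) - a (k+d+1) - a (k+d+2)" for d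
  proof (induction d)
    case (Suc d)
    have "{k<..k + Suc d} = insert (k + Suc d) {k<..k+d}" by auto
    then show ?case using Suc by simp
  qed simp
  have "a (k+1) \<le> a k" "a (k+2) \<le> a k"
    using dec[of k] dec[of "Suc k"] by auto
  show ?thesis
  proof (cases "k \<le> n")
    case True
    then obtain d where "n = k + d" using le_Suc_ex by blast
    then show ?thesis
      using * [of d] nn[of "k+d+1"] nn[of "k+d+2"] \<open>a (k+1) \<le> a k\<close> \<open>a (k+2) \<le> a k\<close> by simp
  next
    case False
    then show ?thesis using nn[of k] by simp
  qed
qed

text \<open>
  Charge every index \<open>k\<close> to the index \<open>j \<ge> k\<close> that maximises \<open>p j / 2 ^ j\<close>. That maximiser is a peak,
  and it receives from the indices below it at most \<open>p j * (1 + 1/2 + 1/4 + ...) = 2 * p j\<close>. So the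
  sum of \<open>p\<close> is at most twice its sum over the peaks. The bound \<open>p \<le> 1\<close> makes \<open>p j / 2 ^ j\<close> tend
  to \<open>0\<close>, so the maximum is attained.
\<close>
lemma not_summable_peaks:
  fixes p :: "nat \<Rightarrow> real"
  assumes pos: "\<And>n. 0 < p n" and le1: "\<And>n. p n \<le> 1" and div: "\<not> summable p"
  shows "\<not> summable (\<lambda>k. if \<forall>j>k. p j \<le> 2 ^ (j - k) * p k then p k else 0)"
proof
  define good where "good = (\<lambda>k. \<forall>j>k. p j \<le> 2 ^ (j - k) * p k)"
  define g where "g = (\<lambda>k. if good k then p k else 0)"
  assume "summable (\<lambda>k. if \<forall>j>k. p j \<le> 2 ^ (j - k) * p k then p k else 0)"
  then have sg: "summable g" by (simp add: g_def good_def)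
  have g0: "0 \<le> g k" for k using pos[of k] by (simp add: g_def)
  have charge: "\<exists>j\<ge>k. good j \<and> p k \<le> p j / 2 ^ (j - k)" for k
  proof -
    define v where "v = (\<lambda>j. p j / 2 ^ j)"
    have "v \<longlonglongrightarrow> 0"
    proof (rule tendsto_sandwich[of "\<lambda>_. 0" _ _ "\<lambda>j. (1/2) ^ j"])
      show "\<forall>\<^sub>F j in sequentially. v j \<le> (1/2) ^ j"
        using le1 by (auto simp: v_def power_one_over divide_simps)
      show "(\<lambda>j. (1/2::real) ^ j) \<longlonglongrightarrow> 0" by (rule LIMSEQ_realpow_zero) auto
    qed (use pos in \<open>auto simp: v_def less_imp_le\<close>)
    moreover have "0 < v k" using pos by (simp add: v_def)
    ultimately have "\<forall>\<^sub>F j in sequentially. v j < v k" by (rule order_tendstoD)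
    then obtain N where N: "\<And>j. j \<ge> N \<Longrightarrow> v j < v k"
      by (auto simp: eventually_sequentially)
    define S where "S = v ` {k..max k N}"
    have "Max S \<in> v ` {k..max k N}"
      unfolding S_def by (intro Max_in) auto
    then obtain j where j: "j \<in> {k..max k N}" "v j = Max S" by (metis imageE)
    \<comment> \<open>\<open>j\<close> maximises \<open>v\<close> over all \<open>i \<ge> k\<close>, as the values beyond \<open>N\<close> are smaller than \<open>v k\<close>.\<close>
    have top: "v i \<le> v j" if "i \<ge> k" for i
    proof (cases "i \<le> max k N")
      case True
      then show ?thesis using that j(2) by (auto simp: S_def)
    next
      case False
      then have "v i < v k" using N by auto
      also have "v k \<le> v j" using j(2) by (auto simp: S_def)
      finally show ?thesis by simp
    qed
    have "good j"
      unfolding good_def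
    proof (intro allI impI)
      fix i assume "j < i"
      then have "v i \<le> v j" using j top by auto
      then show "p i \<le> 2 ^ (i - j) * p j"
        using \<open>j < i\<close> by (simp add: v_def field_simps power_diff)
    qed
    moreover have "p k \<le> p j / 2 ^ (j - k)"
      using top[of k] j(1) by (simp add: v_def field_simps power_diff)
    ultimately show ?thesis using j(1) by auto
  qed
  then obtain t where t: "\<And>k. t k \<ge> k" "\<And>k. good (t k)" "\<And>k. p k \<le> p (t k) / 2 ^ (t k - k)"
    by metis
  have "(\<Sum>k<n. p k) \<le> 2 * suminf g" for n
  proof -
    define J where "J = Suc (Max (insert n (t ` {..<n})))"
    have tJ: "t k < J" if "k < n" for k
      using that by (auto simp: J_def less_Suc_eq_le)
    have "(\<Sum>k<n. p k) \<le> (\<Sum>k<n. \<Sum>j\<in>{k..<J}. g j / 2 ^ (j - k))"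
    proof (rule sum_mono)
      fix k assume "k \<in> {..<n}"
      have "p k \<le> g (t k) / 2 ^ (t k - k)" using t by (simp add: g_def)
      also have "\<dots> \<le> (\<Sum>j\<in>{k..<J}. g j / 2 ^ (j - k))"
        using \<open>k \<in> {..<n}\<close> t(1) tJ g0 
        by (intro member_le_sum[where f = "\<lambda>j. g j / 2 ^ (j - k)"]) auto
      finally show "p k \<le> (\<Sum>j\<in>{k..<J}. g j / 2 ^ (j - k))" .
    qed
    also have "\<dots> = (\<Sum>j<J. \<Sum>k | k < n \<and> k \<le> j. g j / 2 ^ (j - k))"
    proof -
      have "{k..<J} = {j. j \<in> {..<J} \<and> k \<le> j}" for k by auto
      then show ?thesis
        using sum.swap_restrict[of "{..<n}" "{..<J}" "\<lambda>k j. g j / 2 ^ (j - k)" "\<lambda>k j. k \<le> j"] by simp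
    qed
    also have "\<dots> \<le> (\<Sum>j<J. 2 * g j)"
    proof (rule sum_mono)
      fix j
      have "(\<Sum>k | k < n \<and> k \<le> j. g j / 2 ^ (j - k)) \<le> (\<Sum>k\<le>j. g j / 2 ^ (j - k))"
        using g0 by (intro sum_mono2) auto
      also have "\<dots> = g j * (\<Sum>i\<le>j. (1/2) ^ i)"
        unfolding sum_distrib_left
        by (rule sum.reindex_bij_witness[of _ "\<lambda>i. j - i" "\<lambda>i. j - i"])
           (auto simp: power_one_over divide_simps)
      also have "\<dots> \<le> g j * 2"
        by (intro mult_left_mono g0) (simp add: sum_gp0)
      finally show "(\<Sum>k | k < n \<and> k \<le> j. g j / 2 ^ (j - k)) \<le> 2 * g j" by simp
    qed
    also have "\<dots> \<le> 2 * suminf g"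
      by (simp add: sum_distrib_left[symmetric] sum_le_suminf[OF sg] g0)
    finally show ?thesis .
  qed
  then have "summable p"
    using pos by (intro summableI_nonneg_bounded[where x = "2 * suminf g"]) (auto intro: less_imp_le)
  then show False using div by simp
qed

section \<open>A subsequence with divergent series and bounded correlations\<close>

text \<open>
  The partial sums of the weights \<open>w\<close> serve as a clock. Since no weight exceeds \<open>1\<close>, the clock visits
  each interval \<open>{k..<k+1}\<close> and spends total weight at most \<open>2\<close> there. Choosing the index with the largest
  \<open>p\<close> in each interval therefore loses at most a factor \<open>2\<close> of the weighted series.
\<close>
lemma separated_peaks_exist:
  fixes w p :: "nat \<Rightarrow> real"
  assumes w: "\<And>n. 0 \<le> w n" "\<And>n. w n \<le> 1"
    and p: "\<And>n. 0 \<le> p n" "\<And>n. p n \<le> 1"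
    and div: "\<not> summable (\<lambda>n. w n * p n)"
  obtains m where "strict_mono m" "\<not> summable (\<lambda>k. p (m k))"
    "\<And>j k. j < k \<Longrightarrow> real (k - j) - 1 \<le> (\<Sum>i\<in>{m j..<m k}. w i)"
proof -
  define clock where "clock = (\<lambda>n. \<Sum>i<n. w i)"
  define block where "block = (\<lambda>k::nat. {n. real k \<le> clock n \<and> clock n < real k + 1})"
  have clock_mono: "clock a \<le> clock b" if "a \<le> b" for a b
    unfolding clock_def using that w by (intro sum_mono2) auto
  have clock_diff: "clock b - clock a = (\<Sum>i\<in>{a..<b}. w i)" if "a \<le> b" for a b
  proof -
    have "{..<b} = {..<a} \<union> {a..<b}" using that by auto
    then show ?thesis unfolding clock_def by (simp add: sum.union_disjoint ivl_disj_int)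
  qed
  have clock_unbounded: "\<exists>n. x \<le> clock n" for x
  proof (rule ccontr)
    assume "\<nexists>n. x \<le> clock n"
    then have "summable w"
      using w by (intro summableI_nonneg_bounded[where x = x]) (auto simp: clock_def not_le less_imp_le)
    then have "summable (\<lambda>n. w n * p n)"
      using w p by (rule_tac summable_comparison_test'[where N = 0]) (auto simp: mult_left_le abs_mult)
    then show False using div by simp
  qed
  have finite_block: "finite (block k)" for k
  proof -
    obtain N where N: "real k + 1 \<le> clock N" using clock_unbounded by blast
    have "block k \<subseteq> {..<N}"
    proof
      fix n assume "n \<in> block k"
      then have "clock n < clock N" using N by (auto simp: block_def)
      then show "n \<in> {..<N}" using clock_mono[of N n] by (meson lessThan_iff not_le_imp_less leD)
    qed
    then show ?thesis by (rule finite_subset) simp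
  qed
  have block_nonempty: "block k \<noteq> {}" for k
  proof -
    define n where "n = (LEAST n. real k \<le> clock n)"
    have n: "real k \<le> clock n"
      unfolding n_def by (rule LeastI_ex) (rule clock_unbounded)
    have "clock n < real k + 1"
    proof (cases n)
      case 0
      then show ?thesis by (simp add: clock_def)
    next
      case (Suc n')
      then have "\<not> real k \<le> clock n'" unfolding n_def by (intro not_less_Least) simp
      moreover have "clock n \<le> clock n' + 1" using w(2)[of n'] Suc by (simp add: clock_def)
      ultimately show ?thesis by simp
    qed
    then show ?thesis using n by (auto simp: block_def)
  qed
  have weight_block: "(\<Sum>n\<in>block k. w n) \<le> 2" for k
  proof -
    define a where "a = Min (block k)"
    define b where "b = Max (block k)"
    have ab: "a \<in> block k" "b \<in> block k" 
      unfolding a_def b_def using finite_block block_nonempty by (auto intro: Min_in Max_in)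
    have "a \<le> b" unfolding a_def by (rule Min_le[OF finite_block ab(2)])
    have "(\<Sum>n\<in>block k. w n) \<le> (\<Sum>n\<in>{a..<Suc b}. w n)"
      using w finite_block by (intro sum_mono2) (auto simp: a_def b_def less_Suc_eq_le)
    also have "\<dots> = clock b + w b - clock a"
      using clock_diff[of a "Suc b"] \<open>a \<le> b\<close> by (simp add: clock_def)
    also have "\<dots> \<le> 2" using ab w(2)[of b] by (auto simp: block_def)
    finally show ?thesis .
  qed
  have "\<exists>n\<in>block k. \<forall>i\<in>block k. p i \<le> p n" for k
  proof -
    have "Max (p ` block k) \<in> p ` block k"
      using finite_block block_nonempty by (intro Max_in) auto
    then obtain n where "n \<in> block k" "Max (p ` block k) = p n" by (metis imageE)
    then show ?thesis using finite_block by (metis Max_ge finite_imageI imageI)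
  qed
  then obtain m where m: "\<And>k. m k \<in> block k" "\<And>k i. i \<in> block k \<Longrightarrow> p i \<le> p (m k)"
    by metis
  have m_less: "m j < m k" if "j < k" for j k
  proof -
    have "clock (m j) < real j + 1" "real k \<le> clock (m k)"
      using m(1) by (auto simp: block_def)
    then have "clock (m j) < clock (m k)" using that by linarith
    then show ?thesis using clock_mono[of "m k" "m j"] by (meson not_le_imp_less leD)
  qed
  \<comment> \<open>The clock values at \<open>m j\<close> and \<open>m k\<close> lie in the intervals \<open>j\<close> and \<open>k\<close>, so they differ by
    more than \<open>k - j - 1\<close>; this is the separation.\<close>
  show thesis
  proof
    show "strict_mono m" using m_less by (auto simp: strict_mono_def)
  next
    show "\<not> summable (\<lambda>k. p (m k))"
    proof
      assume sm: "summable (\<lambda>k. p (m k))"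
      have "(\<Sum>n<N. w n * p n) \<le> 2 * (\<Sum>k. p (m k))" for N
      proof -
        define K where "K = Suc (nat \<lfloor>clock N\<rfloor>)"
        have "{..<N} \<subseteq> (\<Union>k<K. block k)"
        proof
          fix n assume "n \<in> {..<N}"
          then have "clock n \<le> clock N" by (intro clock_mono) auto
          moreover have "0 \<le> clock n" using w by (auto simp: clock_def intro: sum_nonneg)
          ultimately have "n \<in> block (nat \<lfloor>clock n\<rfloor>)" "nat \<lfloor>clock n\<rfloor> < K"
            by (auto simp: block_def K_def less_Suc_eq_le nat_mono floor_mono)
          then show "n \<in> (\<Union>k<K. block k)" by auto
        qed
        then have "(\<Sum>n<N. w n * p n) \<le> (\<Sum>n\<in>(\<Union>k<K. block k). w n * p n)"
          using w p finite_block by (intro sum_mono2) auto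
        also have "\<dots> = (\<Sum>k<K. \<Sum>n\<in>block k. w n * p n)"
          using finite_block by (intro sum.UNION_disjoint) (auto simp: block_def)
        also have "\<dots> \<le> (\<Sum>k<K. 2 * p (m k))"
        proof (rule sum_mono)
          fix k
          have "(\<Sum>n\<in>block k. w n * p n) \<le> (\<Sum>n\<in>block k. w n * p (m k))"
            using w m(2) by (intro sum_mono mult_left_mono) auto
          also have "\<dots> \<le> 2 * p (m k)"
            unfolding sum_distrib_right[symmetric] using weight_block p by (intro mult_right_mono)
          finally show "(\<Sum>n\<in>block k. w n * p n) \<le> 2 * p (m k)" .
        qed
        also have "\<dots> \<le> 2 * (\<Sum>k. p (m k))"
          using p by (simp add: sum_distrib_left[symmetric] sum_le_suminf[OF sm])
        finally show ?thesis .
      qed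
      then have "summable (\<lambda>n. w n * p n)"
        using w p by (intro summableI_nonneg_bounded[where x = "2 * (\<Sum>k. p (m k))"]) auto
      then show False using div by simp
    qed
  next
    fix j k :: nat assume "j < k"
    have "clock (m j) < real j + 1" "real k \<le> clock (m k)"
      using m(1) by (auto simp: block_def)
    then show "real (k - j) - 1 \<le> (\<Sum>i\<in>{m j..<m k}. w i)"
      using clock_diff[of "m j" "m k"] m_less[OF \<open>j < k\<close>] \<open>j < k\<close> by (simp add: of_nat_diff)
  qed
qed

text \<open>
  In the application \<open>exp (- ((s j - s k) * r j))\<close> is the conditional probability of the \<open>j\<close>-th event
  given the \<open>k\<close>-th, so this is the bound on correlations. There are three regimes. If
  \<open>s k * r j \<le> 1\<close>, conditioning costs at most a factor \<open>exp 1\<close>. If \<open>j - k\<close> is at most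
  \<open>s k * r k / 2\<close>, the exponent \<open>(s j - s k) * r j\<close> is at least \<open>(j - k - 1) / 8\<close>: if it
  were smaller, \<open>peak\<close> would keep \<open>r j\<close> above \<open>r k / 2\<close>, and the separation would make it larger.
  This gives geometric decay in \<open>j - k\<close>. Otherwise \<open>s j\<close> is at least \<open>5/4 * s k\<close>, and
  the terms are dominated by a telescoping sum of reciprocals of \<open>s\<close>. Without \<open>peak\<close> the middle
  part of the sum could be of the order of \<open>ln (s k * r k)\<close>: take \<open>r j\<close> close to \<open>1 / (s j - s k)\<close>.
\<close>
lemma sum_conditional_le:
  fixes s r :: "nat \<Rightarrow> real"
  assumes s_pos: "\<And>n. 0 < s n" and s_mono: "\<And>i j. i \<le> j \<Longrightarrow> s i \<le> s j"
    and r_pos: "\<And>n. 0 < r n" and r_anti: "\<And>i j. i \<le> j \<Longrightarrow> r j \<le> r i"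
    and large: "\<And>n. 4 \<le> s n * r n"
    and sep: "\<And>i j. i < j \<Longrightarrow> real (j - i) - 1 \<le> (s j - s i) * r i"
    and peak: "\<And>j. k < j \<Longrightarrow> exp (- (s j * r j)) \<le> 2 ^ (j - k) * exp (- (s k * r k))"
    and J: "J \<subseteq> {k<..N}"
  shows "(\<Sum>j\<in>J. exp (- ((s j - s k) * r j)))
    \<le> (1 / (1 - exp (- 1 / 8)) + 200) + exp 1 * (\<Sum>j\<in>J. exp (- (s j * r j)))"
proof -
  define g where "g = (\<lambda>j. exp (- 1 / 8 :: real) ^ (j - k - 1))"
  define h where "h = (\<lambda>j. 1 / s j - 1 / s (j + 2))"
  have g0: "0 \<le> g j" for j by (simp add: g_def)
  have h0: "0 \<le> h j" for j
    using s_mono[of j "j + 2"] s_pos[of j] by (simp add: h_def frac_le)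
  have finJ: "finite J" using J by (rule finite_subset) simp
  have bound: "exp (- ((s j - s k) * r j)) \<le> g j + 100 * s k * h j + exp 1 * exp (- (s j * r j))"
    if "k < j" for j
  proof -
    define d where "d = (s j - s k) * r j"
    have d0: "0 \<le> d" using s_mono[of k j] r_pos[of j] \<open>k < j\<close> by (simp add: d_def)
    have i: "1 \<le> real (j - k)" using \<open>k < j\<close> by simp
    consider (late) "s k * r j \<le> 1" | (early) "1 < s k * r j" "real (j - k) \<le> s k * r k / 2"
      | (middle) "1 < s k * r j" "s k * r k / 2 < real (j - k)" by linarith
    then show ?thesis
    proof cases
      case late
      have "exp (- ((s j - s k) * r j)) = exp (s k * r j) * exp (- (s j * r j))"
        by (simp add: exp_add[symmetric] algebra_simps)
      also have "\<dots> \<le> exp 1 * exp (- (s j * r j))"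
        using late by (intro mult_right_mono) auto
      finally show ?thesis using g0[of j] h0[of j] s_pos[of k] by (smt (verit) mult_nonneg_nonneg)
    next
      case early
      have "(real (j - k) - 1) / 8 \<le> d"
      proof (rule ccontr)
        assume neg: "\<not> (real (j - k) - 1) / 8 \<le> d"
        have "exp (- (s j * r j)) \<le> exp (real (j - k) * ln 2 + - (s k * r k))"
          using peak[OF \<open>k < j\<close>] unfolding exp_add exp_of_nat_mult by simp
        then have "s k * r k - s j * r j \<le> real (j - k) * ln 2" by simp
        also have "\<dots> \<le> real (j - k) * (25 / 36)"
          using ln2_le_25_over_36 by (intro mult_left_mono) auto
        also have "s j * r j = s k * r j + d" by (simp add: d_def algebra_simps)
        finally have less: "s k * r k - (s k * r j + d) \<le> real (j - k) * (25 / 36)" .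
        have "s k * r k / 2 \<le> s k * r j"
          using less early neg i large[of k] by argo
        then have "r k / 2 \<le> r j" using s_pos[of k] by simp
        then have "(s j - s k) * (r k / 2) \<le> d"
          unfolding d_def using s_mono[of k j] \<open>k < j\<close> by (intro mult_left_mono) auto
        then show False using sep[OF \<open>k < j\<close>] neg i by simp
      qed
      then have "exp (- d) \<le> exp (- (real (j - k) - 1) / 8)" by simp
      also have "\<dots> = exp (real (j - k - 1) * (- 1 / 8))"
        using \<open>k < j\<close> by (simp add: of_nat_diff field_simps)
      also have "\<dots> = g j" by (simp only: exp_of_nat_mult g_def)
      finally show ?thesis using h0[of j] s_pos[of k] by (simp add: d_def add_increasing2)
    next
      case middle
      have "s k / 4 \<le> s j - s k"
      proof -
        have "s k * r k / 4 \<le> s k * r k / 2 - 1" using large[of k] by linarith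
        also have "\<dots> \<le> (s j - s k) * r k" using sep[OF \<open>k < j\<close>] middle by simp
        finally show ?thesis using r_pos[of k] by (simp add: field_simps)
      qed
      then have "s j * r j / 5 \<le> d"
        using r_pos[of j] by (simp add: d_def field_simps)
      then have "exp (- d) \<le> exp (- (s j * r j / 5))" by simp
      also have "\<dots> \<le> 2 / (s j * r j / 5)\<^sup>2"
        using s_pos[of j] r_pos[of j] by (intro exp_minus_le_inverse_square) simp
      also have "\<dots> = 50 * (1 / (s j * r j)) * (1 / (s j * r j))" by (simp add: power2_eq_square)
      also have "\<dots> \<le> 50 * (s k / s j) * min 1 ((s (j + 2) - s j) / s j)"
      proof (intro mult_mono mult_left_mono)
        show "1 / (s j * r j) \<le> s k / s j"
          using middle s_pos[of j] r_pos[of j] by (simp add: field_simps)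
        have "1 \<le> (s (j + 2) - s j) * r j" using sep[of j "j+2"] by simp
        then show "1 / (s j * r j) \<le> min 1 ((s (j + 2) - s j) / s j)"
          using large[of j] s_pos[of j] r_pos[of j] by (auto simp: field_simps)
      qed (use s_pos[of j] s_pos[of k] r_pos[of j] in auto)
      also have "\<dots> = 50 * s k * (min 1 ((s (j + 2) - s j) / s j) / s j)" by simp
      also have "\<dots> \<le> 50 * s k * (2 * h j)"
        unfolding h_def using s_pos[of k] s_pos[of j] s_mono[of j "j+2"]
        by (intro mult_left_mono relative_increment_le_telescope) auto
      finally show ?thesis using g0[of j] by (simp add: d_def add_increasing add_increasing2)
    qed
  qed
  have "(\<Sum>j\<in>J. exp (- ((s j - s k) * r j)))
      \<le> (\<Sum>j\<in>J. g j + 100 * s k * h j + exp 1 * exp (- (s j * r j)))"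
    using J by (intro sum_mono bound) auto
  also have "\<dots> = (\<Sum>j\<in>J. g j) + 100 * s k * (\<Sum>j\<in>J. h j) + exp 1 * (\<Sum>j\<in>J. exp (- (s j * r j)))"
    by (simp add: sum.distrib sum_distrib_left)
  also have "(\<Sum>j\<in>J. g j) \<le> 1 / (1 - exp (- 1 / 8))"
  proof -
    have "(\<Sum>j\<in>J. g j) \<le> (\<Sum>j\<in>{k<..N}. g j)" using J g0 by (intro sum_mono2) auto
    also have "\<dots> = (\<Sum>i<N - k. exp (- 1 / 8 :: real) ^ i)"
      unfolding g_def by (rule sum.reindex_bij_witness[of _ "\<lambda>i. i + k + 1" "\<lambda>j. j - k - 1"]) auto
    also have "\<dots> \<le> (\<Sum>i. exp (- 1 / 8 :: real) ^ i)"
      by (intro sum_le_suminf summable_geometric) auto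
    also have "\<dots> = 1 / (1 - exp (- 1 / 8))" by (intro suminf_geometric) simp
    finally show ?thesis .
  qed
  also have "100 * s k * (\<Sum>j\<in>J. h j) \<le> 200"
  proof -
    have "(\<Sum>j\<in>J. h j) \<le> (\<Sum>j\<in>{k<..N}. h j)" using J h0 by (intro sum_mono2) auto
    also have "\<dots> \<le> 2 * (1 / s k)"
      unfolding h_def
      by (rule sum_telescope_two_steps_le)
         (use s_pos s_mono in \<open>auto intro!: divide_left_mono simp: less_imp_le\<close>)
    finally show ?thesis using s_pos[of k] by (simp add: field_simps)
  qed
  finally show ?thesis by simp
qed

text \<open>
  Passing to the separated largest terms and then to the peaks among them (the set \<open>G\<close>) keeps the
  series divergent and makes the correlation bound available.
\<close>
lemma divergent_subsequence_with_bounded_correlation: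
  fixes s r :: "nat \<Rightarrow> real"
  assumes s_pos: "\<And>n. 0 < s n" and s_mono: "\<And>i j. i \<le> j \<Longrightarrow> s i \<le> s j"
    and r_pos: "\<And>n. 0 < r n" and r_anti: "\<And>i j. i \<le> j \<Longrightarrow> r j \<le> r i"
    and large: "\<And>n. 4 \<le> s n * r n"
    and div: "\<not> summable (\<lambda>n. (1 - exp (- ((s (Suc n) - s n) * r n))) * exp (- (s n * r n)))"
  obtains m G where "strict_mono m"
    "\<not> summable (\<lambda>k. if k \<in> G then exp (- (s (m k) * r (m k))) else 0)"
    "\<And>k J N. \<lbrakk>k \<in> G; J \<subseteq> {k<..N}\<rbrakk> \<Longrightarrow>
      (\<Sum>j\<in>J. exp (- ((s (m j) - s (m k)) * r (m j))))
        \<le> (1 / (1 - exp (- 1 / 8)) + 200) + exp 1 * (\<Sum>j\<in>J. exp (- (s (m j) * r (m j))))"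
proof -
  define p where "p = (\<lambda>n. exp (- (s n * r n)))"
  define w where "w = (\<lambda>n. 1 - exp (- ((s (Suc n) - s n) * r n)))"
  have w: "0 \<le> w n" "w n \<le> 1" for n
    using s_mono[of n "Suc n"] r_pos[of n] by (auto simp: w_def)
  have p: "0 < p n" "p n \<le> 1" for n
    using s_pos[of n] r_pos[of n] by (auto simp: p_def)
  obtain m where m: "strict_mono m" "\<not> summable (\<lambda>k. p (m k))"
    "\<And>j k. j < k \<Longrightarrow> real (k - j) - 1 \<le> (\<Sum>i\<in>{m j..<m k}. w i)"
    using separated_peaks_exist[of w p] w p div by (auto simp: w_def p_def less_imp_le)
  define G where "G = {k. \<forall>j>k. p (m j) \<le> 2 ^ (j - k) * p (m k)}"
  have m_le: "m i \<le> m j" if "i \<le> j" for i j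
    using m(1) that by (simp add: strict_mono_less_eq)
  have sep: "real (k - j) - 1 \<le> (s (m k) - s (m j)) * r (m j)" if "j < k" for j k
  proof -
    have "real (k - j) - 1 \<le> (\<Sum>i\<in>{m j..<m k}. w i)" using m(3) that .
    also have "\<dots> \<le> (\<Sum>i\<in>{m j..<m k}. (s (Suc i) - s i) * r (m j))"
    proof (rule sum_mono)
      fix i assume i: "i \<in> {m j..<m k}"
      have "w i \<le> (s (Suc i) - s i) * r i"
        using exp_ge_add_one_self[of "- ((s (Suc i) - s i) * r i)"] by (simp add: w_def)
      also have "\<dots> \<le> (s (Suc i) - s i) * r (m j)"
        using i s_mono[of i "Suc i"] by (intro mult_left_mono r_anti) auto
      finally show "w i \<le> (s (Suc i) - s i) * r (m j)" .
    qed
    also have "\<dots> = (s (m k) - s (m j)) * r (m j)"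
      using m_le[of j k] that by (simp add: sum_distrib_right[symmetric] sum_Suc_diff')
    finally show ?thesis .
  qed
  show thesis
  proof
    show "\<not> summable (\<lambda>k. if k \<in> G then exp (- (s (m k) * r (m k))) else 0)"
      using not_summable_peaks[OF p(1) p(2) m(2)] unfolding G_def p_def mem_Collect_eq .
  next
    fix k J N assume "k \<in> G" "J \<subseteq> {k<..N::nat}"
    then show "(\<Sum>j\<in>J. exp (- ((s (m j) - s (m k)) * r (m j))))
        \<le> (1 / (1 - exp (- 1 / 8)) + 200) + exp 1 * (\<Sum>j\<in>J. exp (- (s (m j) * r (m j))))"
      using s_pos s_mono r_pos r_anti large m_le sep
      by (intro sum_conditional_le[of "\<lambda>k. s (m k)" "\<lambda>k. r (m k)"]) (auto simp: G_def p_def)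
  qed (fact m(1))
qed

section \<open>A second moment bound\<close>

lemma square_sum_eq:
  fixes x :: "nat \<Rightarrow> real"
  shows "(\<Sum>k\<in>{K..<N}. x k)\<^sup>2 = (\<Sum>k\<in>{K..<N}. (x k)\<^sup>2) + 2 * (\<Sum>k\<in>{K..<N}. \<Sum>j\<in>{k<..<N}. x k * x j)"
proof (cases "K \<le> N")
  case True
  then show ?thesis
  proof (induction N rule: dec_induct)
    case (step N)
    have "(\<Sum>j\<in>{k<..<Suc N}. x k * x j) = (\<Sum>j\<in>{k<..<N}. x k * x j) + x k * x N" if "k < N" for k
    proof -
      have "{k<..<Suc N} = insert N {k<..<N}" using that by auto
      then show ?thesis by simp
    qed
    then have "(\<Sum>k\<in>{K..<N}. \<Sum>j\<in>{k<..<Suc N}. x k * x j)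
      = (\<Sum>k\<in>{K..<N}. \<Sum>j\<in>{k<..<N}. x k * x j) + (\<Sum>k\<in>{K..<N}. x k) * x N"
      by (simp add: sum.distrib sum_distrib_right)
    moreover have "{N<..<Suc N} = {}" by auto
    ultimately show ?case
      using step by (simp add: power2_sum algebra_simps)
  qed simp
qed simp

text \<open>
  A form of the Kochen--Stone lemma. If \<open>Z\<close> counts how many of the events \<open>A k\<close> with \<open>K \<le> k < N\<close>
  occur, then \<open>2 * u * Z - u\<^sup>2 * Z\<^sup>2 \<le> 1\<close> for every \<open>u\<close>, with \<open>0\<close> on the left when
  \<open>Z = 0\<close>; taking expectations bounds the probability that \<open>Z > 0\<close> from below. The pair bound makes
  the second moment of \<open>Z\<close> comparable to the square of its mean once that mean is large.
\<close>
lemma (in prob_space) prob_tail_Union_ge_kochen_stone: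
  fixes A :: "nat \<Rightarrow> 'a set"
  assumes A[measurable]: "\<And>k. A k \<in> events"
    and div: "\<not> summable (\<lambda>k. prob (A k))"
    and pair: "\<And>k N. (\<Sum>j\<in>{k<..<N}. prob (A k \<inter> A j))
      \<le> prob (A k) * (c + d * (\<Sum>j\<in>{k<..<N}. prob (A j)))"
    and "0 \<le> c" "0 \<le> d"
  shows "1 / (1 + 2 * d) \<le> prob (\<Union>k\<in>{K..}. A k)"
proof -
  have "\<exists>N. 1 + 2 * c \<le> (\<Sum>k\<in>{K..<N}. prob (A k))"
  proof (rule ccontr)
    assume "\<nexists>N. 1 + 2 * c \<le> (\<Sum>k\<in>{K..<N}. prob (A k))"
    then have "(\<Sum>k<N. prob (A (k + K))) \<le> 1 + 2 * c" for N
      using sum.shift_bounds_nat_ivl[of "\<lambda>k. prob (A k)" 0 K N]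
      by (simp add: atLeast0LessThan not_le) (smt (verit, best))
    then have "summable (\<lambda>k. prob (A (k + K)))"
      by (intro summableI_nonneg_bounded) auto
    then show False using div summable_iff_shift[of "\<lambda>k. prob (A k)" K] by simp
  qed
  then obtain N where N: "1 + 2 * c \<le> (\<Sum>k\<in>{K..<N}. prob (A k))" by blast
  \<comment> \<open>\<open>a\<close> is the mean of the count, \<open>a + 2 * b\<close> its second moment, and \<open>u\<close> is chosen
    to maximise \<open>2 * u * a - u\<^sup>2 * v\<close> for the upper bound \<open>v = (1 + 2 * d) * a\<^sup>2\<close> of that moment.\<close>
  define a where "a = (\<Sum>k\<in>{K..<N}. prob (A k))"
  define b where "b = (\<Sum>k\<in>{K..<N}. \<Sum>j\<in>{k<..<N}. prob (A k \<inter> A j))"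
  define u where "u = 1 / ((1 + 2 * d) * a)"
  have a: "1 \<le> a" "1 + 2 * c \<le> a" using N \<open>0 \<le> c\<close> by (auto simp: a_def)
  have "b \<le> (\<Sum>k\<in>{K..<N}. prob (A k) * (c + d * a))"
    unfolding b_def
  proof (rule sum_mono)
    fix k assume "k \<in> {K..<N}"
    have "(\<Sum>j\<in>{k<..<N}. prob (A k \<inter> A j))
      \<le> prob (A k) * (c + d * (\<Sum>j\<in>{k<..<N}. prob (A j)))" by (rule pair)
    also have "\<dots> \<le> prob (A k) * (c + d * a)"
      unfolding a_def using \<open>k \<in> {K..<N}\<close> \<open>0 \<le> d\<close>
      by (intro mult_left_mono add_left_mono sum_mono2) auto
    finally show "(\<Sum>j\<in>{k<..<N}. prob (A k \<inter> A j)) \<le> prob (A k) * (c + d * a)" .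
  qed
  also have "\<dots> = a * (c + d * a)" by (simp add: a_def sum_distrib_right)
  finally have "a + 2 * b \<le> (1 + 2 * c) * a + 2 * d * a\<^sup>2" by (simp add: algebra_simps power2_eq_square)
  also have "\<dots> \<le> a * a + 2 * d * a\<^sup>2" using a by (intro add_right_mono mult_right_mono) auto
  finally have second_moment: "a + 2 * b \<le> (1 + 2 * d) * a\<^sup>2"
    by (simp add: algebra_simps power2_eq_square)
  define Z where "Z = (\<lambda>\<omega>. \<Sum>k\<in>{K..<N}. indicator (A k) \<omega> :: real)"
  have Z_square: "(Z \<omega>)\<^sup>2 = Z \<omega> + 2 * (\<Sum>k\<in>{K..<N}. \<Sum>j\<in>{k<..<N}. indicator (A k \<inter> A j) \<omega>)" for \<omega>
    unfolding Z_def square_sum_eq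
    by (simp add: power2_eq_square indicator_inter_arith[symmetric])
  have iZ: "integrable M Z"
    unfolding Z_def by (intro Bochner_Integration.integrable_sum) (auto simp: emeasure_eq_measure)
  have iY: "integrable M (\<lambda>\<omega>. \<Sum>k\<in>{K..<N}. \<Sum>j\<in>{k<..<N}. indicator (A k \<inter> A j) \<omega> :: real)"
    by (intro Bochner_Integration.integrable_sum) (auto simp: emeasure_eq_measure)
  have "1 / (1 + 2 * d) \<le> 2 * u * a - u\<^sup>2 * (a + 2 * b)"
  proof -
    have "u\<^sup>2 * (a + 2 * b) \<le> u\<^sup>2 * ((1 + 2 * d) * a\<^sup>2)"
      using second_moment by (intro mult_left_mono) auto
    also have "\<dots> = 1 / (1 + 2 * d)"
      using a \<open>0 \<le> d\<close> by (simp add: u_def power2_eq_square)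
    finally have "u\<^sup>2 * (a + 2 * b) \<le> 1 / (1 + 2 * d)" .
    moreover have "2 * u * a = 2 / (1 + 2 * d)"
      using a by (simp add: u_def)
    ultimately show ?thesis by simp
  qed
  also have "\<dots> = expectation (\<lambda>\<omega>. 2 * u * Z \<omega> - u\<^sup>2 * (Z \<omega>)\<^sup>2)"
  proof -
    have "expectation Z = a"
      unfolding Z_def a_def by (subst Bochner_Integration.integral_sum) (auto simp: emeasure_eq_measure)
    moreover have "expectation (\<lambda>\<omega>. \<Sum>k\<in>{K..<N}. \<Sum>j\<in>{k<..<N}. indicator (A k \<inter> A j) \<omega>) = b"
      unfolding b_def
      by (subst Bochner_Integration.integral_sum, force simp: emeasure_eq_measure intro!: Bochner_Integration.integrable_sum)
         (intro sum.cong refl, subst Bochner_Integration.integral_sum, auto simp: emeasure_eq_measure)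
    ultimately show ?thesis unfolding Z_square using iZ iY by simp
  qed
  also have "\<dots> \<le> expectation (indicator (\<Union>k\<in>{K..}. A k))"
  proof (rule integral_mono)
    show "integrable M (\<lambda>\<omega>. 2 * u * Z \<omega> - u\<^sup>2 * (Z \<omega>)\<^sup>2)"
      unfolding Z_square using iZ iY by simp
    show "integrable M (indicator (\<Union>k\<in>{K..}. A k) :: _ \<Rightarrow> real)"
      by (auto simp: emeasure_eq_measure)
    fix \<omega>
    show "2 * u * Z \<omega> - u\<^sup>2 * (Z \<omega>)\<^sup>2 \<le> indicator (\<Union>k\<in>{K..}. A k) \<omega>"
    proof (cases "\<omega> \<in> (\<Union>k\<in>{K..}. A k)")
      case True
      have "0 \<le> (1 - u * Z \<omega>)\<^sup>2" by simp
      then show ?thesis using True by (simp add: power2_eq_square algebra_simps)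
    next
      case False
      then have "Z \<omega> = 0" by (auto simp: Z_def)
      then show ?thesis by simp
    qed
  qed
  also have "\<dots> = prob (\<Union>k\<in>{K..}. A k)" by simp
  finally show ?thesis .
qed

section \<open>Maxima of independent variables and the zero-one law\<close>

locale maxima_of_cdf_powers = prob_space P for P :: "'a measure" +
  fixes X :: "nat \<Rightarrow> 'a \<Rightarrow> real" and F :: "real \<Rightarrow> real" and \<alpha> :: "nat \<Rightarrow> real"
  assumes F_nonneg: "0 \<le> F x" and F_le_1: "F x \<le> 1" and F_mono: "x \<le> y \<Longrightarrow> F x \<le> F y"
    and \<alpha>_pos: "1 \<le> n \<Longrightarrow> 0 < \<alpha> n"
    and indep: "indep_vars (\<lambda>_. borel) X {1..}"
    and cdf_X: "1 \<le> n \<Longrightarrow> cdf (distr P borel (X n)) x = F x powr \<alpha> n"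
begin

abbreviation "s \<equiv> partial_sum \<alpha>"

definition max_le :: "real \<Rightarrow> nat \<Rightarrow> 'a set" where
  "max_le x n = {\<omega> \<in> space P. \<forall>k\<in>{1..n}. X k \<omega> \<le> x}"

lemma X_measurable [measurable]: "1 \<le> k \<Longrightarrow> X k \<in> borel_measurable P"
  using indep by (auto simp: indep_vars_def)

lemma prob_X_le: "1 \<le> k \<Longrightarrow> prob {\<omega> \<in> space P. X k \<omega> \<le> x} = F x powr \<alpha> k"
proof -
  assume k: "1 \<le> k"
  have "prob {\<omega> \<in> space P. X k \<omega> \<le> x} = cdf (distr P borel (X k)) x"
    unfolding cdf_def2 using X_measurable[OF k]
    by (subst measure_distr) (auto intro!: arg_cong[where f = prob])
  then show ?thesis using cdf_X[OF k] by simp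
qed

lemma prob_all_le:
  assumes "finite J" "J \<noteq> {}" "J \<subseteq> {1..}"
  shows "prob {\<omega> \<in> space P. \<forall>k\<in>J. X k \<omega> \<le> u k} = (\<Prod>k\<in>J. F (u k) powr \<alpha> k)"
proof -
  have "{\<omega> \<in> space P. \<forall>k\<in>J. X k \<omega> \<le> u k} = (\<Inter>k\<in>J. X k -` {..u k} \<inter> space P)"
    using assms by auto
  also have "prob \<dots> = (\<Prod>k\<in>J. prob (X k -` {..u k} \<inter> space P))"
    using assms by (intro indep_varsD[OF indep]) auto
  also have "\<dots> = (\<Prod>k\<in>J. F (u k) powr \<alpha> k)"
  proof (rule prod.cong)
    fix k assume "k \<in> J"
    have "X k -` {..u k} \<inter> space P = {\<omega> \<in> space P. X k \<omega> \<le> u k}" by auto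
    then show "prob (X k -` {..u k} \<inter> space P) = F (u k) powr \<alpha> k"
      using prob_X_le[of k "u k"] assms \<open>k \<in> J\<close> by auto
  qed simp
  finally show ?thesis .
qed

lemma max_le_events [measurable]: "max_le x n \<in> events"
proof -
  have "max_le x n = (\<Inter>k\<in>{1..n}. {\<omega> \<in> space P. X k \<omega> \<le> x}) \<inter> space P"
    by (auto simp: max_le_def)
  also have "\<dots> \<in> events"
    by (cases "n = 0") (auto intro!: sets.Int sets.finite_INT)
  finally show ?thesis .
qed

lemma prob_max_le:
  assumes "1 \<le> n"
  shows "prob (max_le x n) = F x powr s n"
proof -
  have "prob (max_le x n) = (\<Prod>k\<in>{1..n}. F x powr \<alpha> k)"
    unfolding max_le_def using assms by (intro prob_all_le) auto
  also have "\<dots> = F x powr s n"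
  proof (cases "F x = 0")
    case True
    then show ?thesis using assms by (auto intro!: bexI[of _ 1])
  next
    case False
    then show ?thesis by (simp add: powr_sum partial_sum_def)
  qed
  finally show ?thesis .
qed

lemma prob_max_le_Int:
  assumes "1 \<le> m" "m < n" "x \<le> y" "0 < F x"
  shows "prob (max_le x m \<inter> max_le y n) = F x powr s m * F y powr (s n - s m)"
proof -
  have "max_le x m \<inter> max_le y n
    = {\<omega> \<in> space P. \<forall>k\<in>{1..n}. X k \<omega> \<le> (if k \<le> m then x else y)}"
  proof (intro equalityI subsetI)
    fix \<omega> assume "\<omega> \<in> {\<omega> \<in> space P. \<forall>k\<in>{1..n}. X k \<omega> \<le> (if k \<le> m then x else y)}"
    then have \<omega>: "\<omega> \<in> space P" "\<And>k. k \<in> {1..n} \<Longrightarrow> X k \<omega> \<le> (if k \<le> m then x else y)" by auto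
    have "X k \<omega> \<le> x" if "k \<in> {1..m}" for k using \<omega>(2)[of k] that assms by simp
    moreover have "X k \<omega> \<le> y" if "k \<in> {1..n}" for k
      using \<omega>(2)[OF that] \<open>x \<le> y\<close> by (simp split: if_splits)
    ultimately show "\<omega> \<in> max_le x m \<inter> max_le y n" using \<omega>(1) by (auto simp: max_le_def)
  qed (auto simp: max_le_def)
  also have "prob \<dots> = (\<Prod>k\<in>{1..n}. F (if k \<le> m then x else y) powr \<alpha> k)"
    using assms by (intro prob_all_le) auto
  also have "{1..n} = {1..m} \<union> {m<..n}" using assms by auto
  also have "(\<Prod>k\<in>{1..m} \<union> {m<..n}. F (if k \<le> m then x else y) powr \<alpha> k)
    = (\<Prod>k\<in>{1..m}. F x powr \<alpha> k) * (\<Prod>k\<in>{m<..n}. F y powr \<alpha> k)"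
    by (subst prod.union_disjoint) auto
  also have "\<dots> = F x powr s m * F y powr (\<Sum>k\<in>{m<..n}. \<alpha> k)"
    using assms F_mono[of x y] by (simp add: powr_sum partial_sum_def)
  also have "(\<Sum>k\<in>{m<..n}. \<alpha> k) = s n - s m"
  proof -
    have "{1..n} = {1..m} \<union> {m<..n}" using assms by auto
    then have "s n = (\<Sum>k\<in>{1..m} \<union> {m<..n}. \<alpha> k)" by (simp only: partial_sum_def)
    also have "\<dots> = s m + (\<Sum>k\<in>{m<..n}. \<alpha> k)"
      unfolding partial_sum_def by (subst sum.union_disjoint) auto
    finally show ?thesis by simp
  qed
  finally show ?thesis .
qed

lemma ev_above_eq:
  "ev_above P X l = {\<omega> \<in> space P. \<forall>\<^sub>F n in sequentially. \<omega> \<notin> max_le (l n) n}"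
proof -
  have "running_max X n \<omega> > l n \<longleftrightarrow> \<omega> \<notin> max_le (l n) n" if "1 \<le> n" "\<omega> \<in> space P" for n \<omega>
    using that by (auto simp: running_max_def max_le_def Max_gr_iff not_le)
  then have "(\<forall>\<^sub>F n in sequentially. running_max X n \<omega> > l n)
      \<longleftrightarrow> (\<forall>\<^sub>F n in sequentially. \<omega> \<notin> max_le (l n) n)" if "\<omega> \<in> space P" for \<omega>
    using that by (intro eventually_cong eventually_sequentiallyI[of 1]) auto
  then show ?thesis by (auto simp: ev_above_def)
qed

lemma ev_above_eq_UN:
  "ev_above P X l = (\<Union>K. space P - (\<Union>n\<in>{K..}. max_le (l n) n))"
  unfolding ev_above_eq eventually_sequentially by auto

lemma ev_above_events [measurable]: "ev_above P X l \<in> events"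
  unfolding ev_above_eq_UN by (intro sets.countable_UN) auto

lemma prob_ev_above_le:
  assumes "\<And>K. \<delta> \<le> prob (\<Union>n\<in>{K..}. max_le (l n) n)"
  shows "prob (ev_above P X l) \<le> 1 - \<delta>"
proof (rule LIMSEQ_le_const2)
  show "(\<lambda>K. prob (space P - (\<Union>n\<in>{K..}. max_le (l n) n))) \<longlonglongrightarrow> prob (ev_above P X l)"
    unfolding ev_above_eq_UN
    by (rule finite_Lim_measure_incseq) (auto simp: incseq_def)
  show "\<exists>N. \<forall>K\<ge>N. prob (space P - (\<Union>n\<in>{K..}. max_le (l n) n)) \<le> 1 - \<delta>"
    using assms by (auto simp: prob_compl)
qed

text \<open>
  As \<open>F (l n)\<close> tends to \<open>1\<close>, each single \<open>X k\<close> almost surely stays below \<open>l n\<close> from some \<open>n\<close> on. So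
  leaving out the first \<open>m\<close> variables changes the event by a null set only, for every \<open>m\<close>; the event
  agrees with a tail event up to a null set, and Kolmogorov's law applies.
\<close>
lemma ev_above_zero_one:
  assumes l: "mono_on {1..} l" and F_l: "(\<lambda>n. F (l n)) \<longlonglongrightarrow> 1"
  shows "prob (ev_above P X l) = 0 \<or> prob (ev_above P X l) = 1"
proof -
  define A where "A = (\<lambda>i. sigma_sets (space P) {X (Suc i) -` B \<inter> space P | B. B \<in> sets borel})"
  define T where "T = (\<lambda>m. {\<omega> \<in> space P. \<forall>\<^sub>F n in sequentially. \<exists>k\<in>{m<..n}. l n < X k \<omega>})"
  have T_antimono: "T b \<subseteq> T a" if "a \<le> b" for a b
    using that by (auto simp: T_def elim!: eventually_mono)
  have "indep_sets A UNIV"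
  proof -
    define H where "H = (\<lambda>i. sigma_sets (space P) {X i -` B \<inter> space P | B. B \<in> sets borel})"
    have H: "indep_sets H {1..}" using indep by (simp add: indep_vars_def H_def)
    show ?thesis
    proof (rule indep_setsI)
      show "A i \<subseteq> events" for i
        using H by (auto simp: indep_sets_def A_def H_def)
    next
      fix B J assume J: "J \<noteq> {}" "finite J" "\<forall>j\<in>J. B j \<in> A j"
      have "prob (\<Inter>j\<in>Suc ` J. B (j - 1)) = (\<Prod>j\<in>Suc ` J. prob (B (j - 1)))"
        using J by (intro indep_setsD[OF H]) (auto simp: A_def H_def)
      then show "prob (\<Inter>j\<in>J. B j) = (\<Prod>j\<in>J. prob (B j))"
        by (simp add: prod.reindex)
    qed
  qed
  moreover have "sigma_algebra (space P) (A i)" for i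
    unfolding A_def by (intro sigma_algebra_sigma_sets) auto
  moreover have A_events: "A i \<subseteq> events" for i
    using calculation(1) by (auto simp: indep_sets_def)
  moreover have tail: "(\<Inter>m. T m) \<in> tail_events A"
    unfolding tail_events_def
  proof
    fix N
    interpret S: sigma_algebra "space P" "sigma_sets (space P) (\<Union> (A ` {N..}))"
      by (intro sigma_algebra_sigma_sets) (auto simp: A_def dest: sigma_sets_into_sp[rotated])
    have X_S: "{\<omega> \<in> space P. x < X k \<omega>} \<in> sigma_sets (space P) (\<Union> (A ` {N..}))" if "N < k" for k x
    proof -
      define i where "i = k - 1"
      have i: "k = Suc i" "N \<le> i" using that by (auto simp: i_def)
      have "X (Suc i) -` {x<..} \<inter> space P \<in> A i"
        unfolding A_def by (intro sigma_sets.Basic CollectI exI[of _ "{x<..}"]) auto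
      also have "X (Suc i) -` {x<..} \<inter> space P = {\<omega> \<in> space P. x < X k \<omega>}"
        using i by auto
      finally show ?thesis using i by (intro sigma_sets.Basic) auto
    qed
    have T_S: "T m \<in> sigma_sets (space P) (\<Union> (A ` {N..}))" if "N \<le> m" for m
    proof -
      have "T m = (\<Union>n0. \<Inter>n\<in>{n0..}. \<Union>k\<in>{m<..n}. {\<omega> \<in> space P. l n < X k \<omega>})"
        by (auto simp: T_def eventually_sequentially) (meson atLeast_iff order_refl)+
      also have "\<dots> \<in> sigma_sets (space P) (\<Union> (A ` {N..}))"
        using that by (intro S.countable_UN S.countable_INT' S.countable_UN' image_subsetI X_S) auto
      finally show ?thesis .
    qed
    have "(\<Inter>m. T m) = (\<Inter>m\<in>{N..}. T m)"
      using T_antimono by (auto) (meson atLeast_iff in_mono linear order_refl)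
    also have "\<dots> \<in> sigma_sets (space P) (\<Union> (A ` {N..}))"
      using T_S by (intro S.countable_INT) auto
    finally show "(\<Inter>m. T m) \<in> sigma_sets (space P) (\<Union> (A ` {N..}))" .
  qed
  ultimately have T01: "prob (\<Inter>m. T m) = 0 \<or> prob (\<Inter>m. T m) = 1"
    by (intro kolmogorov_0_1_law)
  have AE_le: "AE \<omega> in P. \<forall>\<^sub>F n in sequentially. X k \<omega> \<le> l n" if "1 \<le> k" for k
  proof -
    define D where "D = {\<omega> \<in> space P. \<forall>n\<in>{1..}. l n < X k \<omega>}"
    have D_eq: "D = space P \<inter> (\<Inter>n\<in>{1..}. {\<omega> \<in> space P. l n < X k \<omega>})"
      by (auto simp: D_def)
    have D[measurable]: "D \<in> events"
      unfolding D_eq using that by (intro sets.Int sets.countable_INT') auto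
    have "prob D \<le> 0"
    proof (rule LIMSEQ_le_const)
      have "(\<lambda>n. 1 - F (l n) powr \<alpha> k) \<longlonglongrightarrow> 1 - 1 powr \<alpha> k"
        using F_l by (intro tendsto_intros) auto
      then show "(\<lambda>n. 1 - F (l n) powr \<alpha> k) \<longlonglongrightarrow> 0" by simp
      have "prob D \<le> 1 - F (l n) powr \<alpha> k" if "1 \<le> n" for n
      proof -
        have le[measurable]: "{\<omega> \<in> space P. X k \<omega> \<le> l n} \<in> events"
          using \<open>1 \<le> k\<close> by measurable
        have "prob D \<le> prob (space P - {\<omega> \<in> space P. X k \<omega> \<le> l n})"
          using that le by (intro finite_measure_mono) (auto simp: D_def Ball_def not_le)
        also have "\<dots> = 1 - F (l n) powr \<alpha> k"
          using prob_X_le[OF \<open>1 \<le> k\<close>] le by (simp add: prob_compl)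
        finally show ?thesis .
      qed
      then show "\<exists>N. \<forall>n\<ge>N. prob D \<le> 1 - F (l n) powr \<alpha> k" by blast
    qed
    then have "D \<in> null_sets P"
      using measure_nonneg[of P D] D by (auto simp: null_sets_def emeasure_eq_measure)
    then show ?thesis
    proof (rule AE_I')
      show "{\<omega> \<in> space P. \<not> (\<forall>\<^sub>F n in sequentially. X k \<omega> \<le> l n)} \<subseteq> D"
      proof
        fix \<omega> assume \<omega>: "\<omega> \<in> {\<omega> \<in> space P. \<not> (\<forall>\<^sub>F n in sequentially. X k \<omega> \<le> l n)}"
        have "l n < X k \<omega>" if "1 \<le> n" for n
        proof (rule ccontr)
          assume "\<not> l n < X k \<omega>"
          then have "X k \<omega> \<le> l i" if "n \<le> i" for i
            using mono_onD[OF l, of n i] \<open>1 \<le> n\<close> that by simp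
          then show False using \<omega> by (auto simp: eventually_sequentially)
        qed
        then show "\<omega> \<in> D" using \<omega> by (auto simp: D_def)
      qed
    qed
  qed
  have "AE \<omega> in P. \<forall>k. 1 \<le> k \<longrightarrow> (\<forall>\<^sub>F n in sequentially. X k \<omega> \<le> l n)"
    using AE_le by (simp add: AE_all_countable)
  then have AE_eq: "AE \<omega> in P. \<omega> \<in> ev_above P X l \<longleftrightarrow> \<omega> \<in> (\<Inter>m. T m)"
  proof eventually_elim
    case (elim \<omega>)
    have T_0: "T 0 = ev_above P X l"
    proof -
      have "(\<exists>k\<in>{0<..n}. l n < X k \<omega>) \<longleftrightarrow> \<omega> \<notin> max_le (l n) n" if "\<omega> \<in> space P" for n \<omega>
        using that by (auto simp: max_le_def not_le Suc_le_eq)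
      then show ?thesis by (auto simp: T_def ev_above_eq)
    qed
    have "\<omega> \<in> T m" if "\<omega> \<in> T 0" for m
    proof -
      have "\<forall>\<^sub>F n in sequentially. \<forall>k\<in>{1..m}. X k \<omega> \<le> l n"
        using elim by (intro eventually_ball_finite) auto
      moreover have "\<forall>\<^sub>F n in sequentially. \<exists>k\<in>{0<..n}. l n < X k \<omega>"
        using that by (simp add: T_def)
      ultimately have "\<forall>\<^sub>F n in sequentially. \<exists>k\<in>{m<..n}. l n < X k \<omega>"
      proof eventually_elim
        case (elim n)
        then obtain k where k: "k \<in> {0<..n}" "l n < X k \<omega>" by blast
        have "\<not> k \<le> m"
        proof
          assume "k \<le> m"
          then have "X k \<omega> \<le> l n" using elim(1) k(1) by auto
          then show False using k(2) by simp
        qed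
        then show ?case using k by (intro bexI[of _ k]) auto
      qed
      then show ?thesis using that by (simp add: T_def)
    qed
    then show ?case using T_0 by auto
  qed
  have "(\<Inter>m. T m) \<in> events"
    using tail tail_events_sets[of A] A_events by blast
  then have "prob (ev_above P X l) = prob (\<Inter>m. T m)"
    using AE_eq by (intro finite_measure_eq_AE) auto
  then show ?thesis using T01 by simp
qed

end

section \<open>Bounded levels, recurrence and convergence of the series\<close>

text \<open>
  The probabilities of interest are exponentials in \<open>- ln (1 - q)\<close>, the criterion is stated in terms
  of \<open>q\<close>; these bounds translate between them.
\<close>
lemma minus_ln_one_minus_bounds:
  fixes x :: real
  assumes "0 \<le> x" "x \<le> 1 / 2"
  shows "x \<le> - ln (1 - x)" "- ln (1 - x) \<le> x + 2 * x\<^sup>2" "- ln (1 - x) \<le> 2 * x"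
proof -
  show "x \<le> - ln (1 - x)" using ln_one_minus_pos_upper_bound[of x] assms by simp
  show le: "- ln (1 - x) \<le> x + 2 * x\<^sup>2" using ln_one_minus_pos_lower_bound[of x] assms by simp
  have "2 * x\<^sup>2 \<le> 2 * (x * (1 / 2))"
    unfolding power2_eq_square using assms by (intro mult_left_mono) auto
  then show "- ln (1 - x) \<le> 2 * x" using le by simp
qed

lemma K_series_eq:
  "K_series \<alpha> q = (\<Sum>i. ennreal (exp (- (partial_sum \<alpha> (Suc i) * q (Suc i))) * (1 - exp (- (\<alpha> (Suc i + 1) * q (Suc i))))))"
  by (simp add: K_series_def Let_def)

lemma summable_if_K_series_finite:
  assumes "K_series \<alpha> q < \<infinity>" "\<And>n. 1 \<le> n \<Longrightarrow> 0 \<le> q n" "\<And>n. 1 \<le> n \<Longrightarrow> 0 < \<alpha> n"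
  shows "summable (\<lambda>n. exp (- (partial_sum \<alpha> n * q n)) * (1 - exp (- (\<alpha> (n + 1) * q n))))"
proof -
  have "summable (\<lambda>i. exp (- (partial_sum \<alpha> (Suc i) * q (Suc i))) * (1 - exp (- (\<alpha> (Suc i + 1) * q (Suc i)))))"
    using assms unfolding K_series_eq
    by (intro summable_suminf_not_top) (auto intro!: mult_nonneg_nonneg simp: less_imp_le)
  then show ?thesis by (subst (asm) summable_Suc_iff)
qed

lemma not_summable_if_K_series_infinite:
  assumes "K_series \<alpha> q = \<infinity>" "\<And>n. 1 \<le> n \<Longrightarrow> 0 \<le> q n" "\<And>n. 1 \<le> n \<Longrightarrow> 0 < \<alpha> n"
  shows "\<not> summable (\<lambda>n. exp (- (partial_sum \<alpha> n * q n)) * (1 - exp (- (\<alpha> (n + 1) * q n))))"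
proof
  assume "summable (\<lambda>n. exp (- (partial_sum \<alpha> n * q n)) * (1 - exp (- (\<alpha> (n + 1) * q n))))"
  then have *: "summable (\<lambda>i. exp (- (partial_sum \<alpha> (Suc i) * q (Suc i))) * (1 - exp (- (\<alpha> (Suc i + 1) * q (Suc i)))))"
    by (subst summable_Suc_iff)
  have "K_series \<alpha> q = ennreal (\<Sum>i. exp (- (partial_sum \<alpha> (Suc i) * q (Suc i))) * (1 - exp (- (\<alpha> (Suc i + 1) * q (Suc i)))))"
    unfolding K_series_eq using assms
    by (intro suminf_ennreal2 *) (auto intro!: mult_nonneg_nonneg simp: less_imp_le)
  then show False using assms(1) by simp
qed

context maxima_of_cdf_powers
begin

lemma s_mono: "m \<le> n \<Longrightarrow> s m \<le> s n"
  unfolding partial_sum_def using \<alpha>_pos by (intro sum_mono2) (auto simp: less_imp_le)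

lemma s_Suc: "s (Suc n) = s n + \<alpha> (Suc n)"
  by (simp add: partial_sum_def)

lemma s_nonneg: "0 \<le> s n"
  using s_mono[of 0 n] by (simp add: partial_sum_def)

lemma s_pos: "1 \<le> n \<Longrightarrow> 0 < s n"
  unfolding partial_sum_def using \<alpha>_pos by (intro sum_pos) auto

lemma prob_ev_above_eq_1_if_bounded:
  assumes L: "F L < 1" "\<And>n. 1 \<le> n \<Longrightarrow> l n \<le> L" and s: "filterlim s at_top sequentially"
  shows "prob (ev_above P X l) = 1"
proof -
  have "(\<lambda>n. F L powr s n) \<longlonglongrightarrow> 0"
  proof (cases "F L = 0")
    case False
    then have "0 < F L" using F_nonneg[of L] by simp
    then have "filterlim (\<lambda>n. ln (F L) * s n) at_bot sequentially"
      using L by (intro filterlim_tendsto_neg_mult_at_bot[OF tendsto_const _ s]) simp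
    then have "(\<lambda>n. exp (ln (F L) * s n)) \<longlonglongrightarrow> 0"
      by (rule filterlim_compose[OF exp_at_bot])
    then show ?thesis using False by (simp add: powr_def mult.commute)
  qed simp
  moreover have "prob (\<Inter>n. max_le L n) \<le> F L powr s n" if "1 \<le> n" for n
  proof -
    have "prob (\<Inter>n. max_le L n) \<le> prob (max_le L n)"
      by (intro finite_measure_mono) auto
    then show ?thesis using prob_max_le[OF that] by simp
  qed
  ultimately have "prob (\<Inter>n. max_le L n) \<le> 0"
    by (intro LIMSEQ_le_const[of "\<lambda>n. F L powr s n"]) blast+
  moreover have "1 - prob (\<Inter>n. max_le L n) \<le> prob (ev_above P X l)"
  proof -
    have "space P - (\<Inter>n. max_le L n) \<subseteq> ev_above P X l"
    proof
      fix \<omega> assume "\<omega> \<in> space P - (\<Inter>n. max_le L n)"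
      then obtain N k where k: "\<omega> \<in> space P" "k \<in> {1..N}" "L < X k \<omega>"
        by (auto simp: max_le_def not_le)
      have "\<omega> \<notin> max_le (l n) n" if "N \<le> n" for n
        using k that L(2)[of n] by (auto simp: max_le_def not_le intro!: bexI[of _ k])
      then show "\<omega> \<in> ev_above P X l"
        unfolding ev_above_eq eventually_sequentially using k by auto
    qed
    then have "prob (space P - (\<Inter>n. max_le L n)) \<le> prob (ev_above P X l)"
      by (intro finite_measure_mono) auto
    then show ?thesis by (subst (asm) prob_compl) auto
  qed
  ultimately show ?thesis using prob_le_1[of "ev_above P X l"] by linarith
qed

lemma tail_seq_nonneg: "0 \<le> tail_seq F l n"
  using F_le_1 by (simp add: tail_seq_def)

lemma tendsto_F_if_tail_seq:
  "tail_seq F l \<longlonglongrightarrow> 0 \<Longrightarrow> (\<lambda>n. F (l n)) \<longlonglongrightarrow> 1"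
  using tendsto_diff[OF tendsto_const[of 1], of "tail_seq F l" 0] by (simp add: tail_seq_def)

text \<open>
  The zero-one law turns a uniform positive lower bound into certainty.
\<close>
lemma prob_ev_above_eq_0_if_recurrent:
  assumes "mono_on {1..} l" "tail_seq F l \<longlonglongrightarrow> 0"
    and "0 < \<delta>" "\<And>K. \<delta> \<le> prob (\<Union>n\<in>{K..}. max_le (l n) n)"
  shows "prob (ev_above P X l) = 0"
  using ev_above_zero_one[OF assms(1) tendsto_F_if_tail_seq[OF assms(2)]]
    prob_ev_above_le[of \<delta> l] assms(3,4) by auto

lemma prob_ev_above_eq_0_if_frequently_bounded:
  assumes l: "mono_on {1..} l" and q: "tail_seq F l \<longlonglongrightarrow> 0"
    and bd: "\<exists>\<^sub>F n in sequentially. s n * tail_seq F l n < B"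
  shows "prob (ev_above P X l) = 0"
proof (rule prob_ev_above_eq_0_if_recurrent[OF l q, of "exp (- 2 * B)"])
  fix K
  have "\<forall>\<^sub>F n in sequentially. tail_seq F l n < 1 / 2"
    using q by (rule order_tendstoD) simp
  moreover have "\<forall>\<^sub>F n in sequentially. max 1 K \<le> n" by (rule eventually_ge_at_top)
  ultimately have "\<forall>\<^sub>F n in sequentially. tail_seq F l n < 1 / 2 \<and> max 1 K \<le> n"
    by eventually_elim simp
  from frequently_ex[OF frequently_eventually_frequently[OF bd this]]
  obtain n where n: "s n * tail_seq F l n < B" "tail_seq F l n < 1 / 2" "1 \<le> n" "K \<le> n"
    by auto
  define x where "x = tail_seq F l n"
  have F_x: "F (l n) = 1 - x" by (simp add: x_def tail_seq_def)
  have x: "0 \<le> x" "x \<le> 1 / 2" using n tail_seq_nonneg[of l n] by (auto simp: x_def)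
  have "s n * - ln (1 - x) \<le> s n * (2 * x)"
    using minus_ln_one_minus_bounds(3)[OF x] s_nonneg by (intro mult_left_mono) auto
  then have "- 2 * B \<le> s n * ln (1 - x)" using n(1) by (simp add: x_def)
  then have "exp (- 2 * B) \<le> F (l n) powr s n"
    using x by (simp add: F_x powr_def)
  also have "\<dots> = prob (max_le (l n) n)" using prob_max_le n by simp
  also have "\<dots> \<le> prob (\<Union>n\<in>{K..}. max_le (l n) n)"
    using n by (intro finite_measure_mono sets.countable_UN'') auto
  finally show "exp (- 2 * B) \<le> prob (\<Union>n\<in>{K..}. max_le (l n) n)" .
qed simp

lemma prob_max_le_eq_exp:
  assumes "1 \<le> n" "tail_seq F l n \<le> 1 / 2"
  shows "prob (max_le (l n) n) = exp (- (s n * - ln (F (l n))))"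
proof -
  have "0 < F (l n)" using assms(2) by (simp add: tail_seq_def)
  then show ?thesis using prob_max_le[OF assms(1)] by (simp add: powr_def)
qed

text \<open>
  For large \<open>n\<close> twice the \<open>n\<close>-th term of the series bounds the probability of the exit
  event \<open>E n\<close>: the maximum is at most \<open>l n\<close> at time \<open>n\<close> and exceeds \<open>l n\<close> at time \<open>n + 1\<close>. By
  Borel--Cantelli only finitely many exits occur. As \<open>l\<close> is non-decreasing, a path that falls below
  \<open>l\<close> after the last exit stays there for ever, and this has probability \<open>0\<close> because the
  probability of being below \<open>l n\<close> at time \<open>n\<close> tends to \<open>0\<close>.
\<close>
lemma prob_ev_above_eq_1_if_summable:
  assumes l: "mono_on {1..} l" and q: "tail_seq F l \<longlonglongrightarrow> 0"
    and sq: "filterlim (\<lambda>n. s n * tail_seq F l n) at_top sequentially"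
    and K: "summable (\<lambda>n. exp (- (s n * tail_seq F l n)) * (1 - exp (- (\<alpha> (n + 1) * tail_seq F l n))))"
  shows "prob (ev_above P X l) = 1"
proof -
  define B where "B = (\<lambda>n. max_le (l n) n)"
  define E where "E = (\<lambda>n. max_le (l n) n - max_le (l n) (Suc n))"
  have half: "\<forall>\<^sub>F n in sequentially. tail_seq F l n < 1 / 2 \<and> 1 \<le> n"
    using order_tendstoD(2)[OF q, of "1/2"] eventually_ge_at_top[of 1] by (simp add: eventually_conj)
  have "summable (\<lambda>n. prob (E n))"
  proof (rule summable_comparison_test_ev)
    show "summable (\<lambda>n. 2 * (exp (- (s n * tail_seq F l n)) * (1 - exp (- (\<alpha> (n + 1) * tail_seq F l n)))))"
      by (rule summable_mult[OF K])
    show "\<forall>\<^sub>F n in sequentially. norm (prob (E n))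
      \<le> 2 * (exp (- (s n * tail_seq F l n)) * (1 - exp (- (\<alpha> (n + 1) * tail_seq F l n))))"
      using half
    proof eventually_elim
      case (elim n)
      define x where "x = tail_seq F l n"
      define y where "y = - ln (1 - x)"
      define z where "z = exp (- (\<alpha> (n + 1) * x))"
      have F_x: "F (l n) = 1 - x" by (simp add: x_def tail_seq_def)
      have x: "0 \<le> x" "x \<le> 1 / 2" using elim tail_seq_nonneg[of l n] by (auto simp: x_def)
      have y: "x \<le> y" "y \<le> 2 * x" using minus_ln_one_minus_bounds[OF x] by (auto simp: y_def)
      have \<alpha>: "0 \<le> \<alpha> (n + 1)" using \<alpha>_pos[of "n + 1"] by simp
      have z: "0 \<le> z" "z \<le> 1" using x \<alpha> by (auto simp: z_def)
      have "prob (E n) = F (l n) powr s n - F (l n) powr s (Suc n)"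
        unfolding E_def using elim prob_max_le[of n] prob_max_le[of "Suc n"]
        by (subst finite_measure_Diff) (auto simp: max_le_def)
      also have "\<dots> = exp (- (s n * y)) * (1 - exp (- (\<alpha> (n + 1) * y)))"
        using x by (simp add: F_x powr_def y_def s_Suc ring_distribs exp_add[symmetric])
      also have "\<dots> \<le> exp (- (s n * x)) * (2 * (1 - z))"
      proof (rule mult_mono)
        show "exp (- (s n * y)) \<le> exp (- (s n * x))"
          using y s_nonneg by (simp add: mult_left_mono)
        have "\<alpha> (n + 1) * y \<le> \<alpha> (n + 1) * (2 * x)" using y \<alpha> by (intro mult_left_mono)
        then have "1 - exp (- (\<alpha> (n + 1) * y)) \<le> 1 - exp (- (\<alpha> (n + 1) * (2 * x)))" by simp
        also have "exp (- (\<alpha> (n + 1) * (2 * x))) = z * z"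
          by (simp add: z_def exp_add[symmetric])
        also have "1 - z * z = (1 + z) * (1 - z)" by (simp add: algebra_simps)
        also have "\<dots> \<le> 2 * (1 - z)" using z by (intro mult_right_mono) auto
        finally show "1 - exp (- (\<alpha> (n + 1) * y)) \<le> 2 * (1 - z)" .
      qed (use x y \<alpha> in auto)
      finally show ?case by (simp add: z_def x_def algebra_simps)
    qed
  qed
  then have AE_E: "AE \<omega> in P. \<forall>\<^sub>F n in sequentially. \<omega> \<in> space P - E n"
    by (intro borel_cantelli_AE1) (auto simp: E_def emeasure_eq_measure)
  have "(\<lambda>n. prob (B n)) \<longlonglongrightarrow> 0"
  proof (rule tendsto_sandwich[of "\<lambda>_. 0" _ _ "\<lambda>n. exp (- (s n * tail_seq F l n))"])
    have "filterlim (\<lambda>n. - (s n * tail_seq F l n)) at_bot sequentially"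
      using sq by (simp add: filterlim_uminus_at_bot)
    then show "(\<lambda>n. exp (- (s n * tail_seq F l n))) \<longlonglongrightarrow> 0"
      by (rule filterlim_compose[OF exp_at_bot])
    show "\<forall>\<^sub>F n in sequentially. prob (B n) \<le> exp (- (s n * tail_seq F l n))"
      using half
    proof eventually_elim
      case (elim n)
      have "tail_seq F l n \<le> - ln (F (l n))"
        using minus_ln_one_minus_bounds(1)[of "tail_seq F l n"] elim tail_seq_nonneg[of l n]
        by (simp add: tail_seq_def)
      then have "s n * tail_seq F l n \<le> s n * - ln (F (l n))"
        by (intro mult_left_mono s_nonneg)
      then show ?case using elim by (simp add: B_def prob_max_le_eq_exp)
    qed
  qed auto
  have stuck: "(\<Inter>n\<in>{N..}. B n) \<in> null_sets P" for N
  proof -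
    have [measurable]: "(\<Inter>n\<in>{N..}. B n) \<in> events"
      by (intro sets.countable_INT') (auto simp: B_def)
    have "prob (\<Inter>n\<in>{N..}. B n) \<le> 0"
    proof (rule LIMSEQ_le_const[OF \<open>(\<lambda>n. prob (B n)) \<longlonglongrightarrow> 0\<close>])
      have "prob (\<Inter>n\<in>{N..}. B n) \<le> prob (B n)" if "N \<le> n" for n
        using that by (intro finite_measure_mono) (auto simp: B_def)
      then show "\<exists>M. \<forall>n\<ge>M. prob (\<Inter>n\<in>{N..}. B n) \<le> prob (B n)" by blast
    qed
    then show ?thesis by (simp add: null_sets_def emeasure_eq_measure measure_le_0_iff)
  qed
  have "AE \<omega> in P. \<forall>N. \<omega> \<notin> (\<Inter>n\<in>{N..}. B n)"
    unfolding AE_all_countable using stuck AE_not_in by blast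
  with AE_E have "AE \<omega> in P. \<omega> \<in> ev_above P X l"
  proof eventually_elim
    case (elim \<omega>)
    obtain N where N: "\<And>n. N \<le> n \<Longrightarrow> \<omega> \<in> space P - E n"
      using elim(1) by (auto simp: eventually_sequentially)
    have "\<omega> \<notin> B n" if n: "max 1 N \<le> n" for n
    proof
      assume "\<omega> \<in> B n"
      have "\<omega> \<in> B i" if "n \<le> i" for i
        using that
      proof (induction i rule: dec_induct)
        case (step i)
        then have "\<omega> \<in> max_le (l i) (Suc i)" using N[of i] n by (auto simp: B_def E_def)
        moreover have "l i \<le> l (Suc i)" using mono_onD[OF l, of i "Suc i"] step n by simp
        ultimately show ?case by (force simp: B_def max_le_def)
      qed (fact \<open>\<omega> \<in> B n\<close>)
      then show False using elim(2) by auto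
    qed
    then show ?case using N[of N] unfolding ev_above_eq B_def eventually_sequentially by blast
  qed
  then show ?thesis by (subst prob_eq_1) auto
qed

end

section \<open>Divergence of the series\<close>

context maxima_of_cdf_powers
begin

lemma prob_max_le_Int_eq_exp:
  assumes "1 \<le> m" "m < n" "l m \<le> l n" "0 < F (l m)"
  shows "prob (max_le (l m) m \<inter> max_le (l n) n)
    = exp (- (s m * - ln (F (l m)))) * exp (- ((s n - s m) * - ln (F (l n))))"
  using prob_max_le_Int[OF assms] assms F_mono[OF assms(3)] by (simp add: powr_def)

text \<open>
  Replacing \<open>q\<close> by \<open>- ln (1 - q)\<close> multiplies \<open>exp (- (s * q))\<close> by a factor that is only bounded below
  where \<open>s * q\<^sup>2\<close> is bounded. Where \<open>s * q\<^sup>2 > 1\<close>, the quantity \<open>s * q\<close> exceeds the square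
  root of \<open>s\<close>, and the corresponding terms are dominated by a telescoping sum. Hence only the
  indices with \<open>s * q\<^sup>2 \<le> 1\<close> matter for divergence.
\<close>
lemma recurrence_series_diverges:
  assumes s: "filterlim s at_top sequentially"
    and N0: "1 \<le> N0" "\<And>n. N0 \<le> n \<Longrightarrow> tail_seq F l n \<le> 1 / 2"
      "\<And>n. N0 \<le> n \<Longrightarrow> 4 \<le> s n * tail_seq F l n"
    and K: "\<not> summable (\<lambda>n. exp (- (s n * tail_seq F l n)) * (1 - exp (- (\<alpha> (n + 1) * tail_seq F l n))))"
  shows "\<not> summable (\<lambda>n. (1 - exp (- ((s (Suc n + N0) - s (n + N0)) * - ln (F (l (n + N0))))))
     * exp (- (s (n + N0) * - ln (F (l (n + N0))))))"
proof
  define S where "S = (\<lambda>n. s (n + N0))"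
  define q where "q = (\<lambda>n. tail_seq F l (n + N0))"
  define r where "r = (\<lambda>n. - ln (F (l (n + N0))))"
  define f where "f = (\<lambda>n. (1 - exp (- ((S (Suc n) - S n) * r n))) * exp (- (S n * r n)))"
  define g where "g = (\<lambda>n. exp (- (S n * q n)) * (1 - exp (- ((S (Suc n) - S n) * q n))))"
  assume "summable (\<lambda>n. (1 - exp (- ((s (Suc n + N0) - s (n + N0)) * - ln (F (l (n + N0))))))
     * exp (- (s (n + N0) * - ln (F (l (n + N0))))))"
  then have "summable f" by (simp add: f_def S_def r_def)
  moreover have "summable (\<lambda>n. 1 / S n - 1 / S (Suc n))"
  proof (rule telescope_summable')
    have "filterlim S at_top sequentially"
      unfolding S_def by (rule filterlim_compose[OF s filterlim_add_const_nat_at_top])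
    then show "(\<lambda>n. 1 / S n) \<longlonglongrightarrow> 0"
      by (intro real_tendsto_divide_at_top[OF tendsto_const])
  qed
  ultimately have "summable (\<lambda>n. exp 2 * f n + 128 * (1 / S n - 1 / S (Suc n)))"
    by (intro summable_add summable_mult)
  moreover have "norm (g n) \<le> exp 2 * f n + 128 * (1 / S n - 1 / S (Suc n))" for n
  proof -
    have q: "0 \<le> q n" "q n \<le> 1 / 2" "4 \<le> S n * q n"
      using N0 tail_seq_nonneg by (auto simp: q_def S_def)
    have r: "q n \<le> r n" "r n \<le> q n + 2 * (q n)\<^sup>2"
      using minus_ln_one_minus_bounds[OF q(1,2)] by (auto simp: r_def q_def tail_seq_def)
    have S: "0 < S n" "S n \<le> S (Suc n)"
      using s_pos[of "n + N0"] s_mono N0(1) by (auto simp: S_def)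
    define a where "a = S (Suc n) - S n"
    have a: "0 \<le> a" using S by (simp add: a_def)
    have g0: "0 \<le> g n" using q a by (simp add: g_def a_def)
    have f0: "0 \<le> f n" using q r a by (simp add: f_def a_def)
    have frac0: "0 \<le> 1 / S n - 1 / S (Suc n)" using S by (simp add: frac_le)
    show ?thesis
    proof (cases "S n * (q n)\<^sup>2 \<le> 1")
      case True
      have "S n * r n \<le> S n * (q n + 2 * (q n)\<^sup>2)" using r S by (intro mult_left_mono) auto
      also have "\<dots> = S n * q n + 2 * (S n * (q n)\<^sup>2)" by (simp add: algebra_simps)
      also have "\<dots> \<le> S n * q n + 2" using True by simp
      finally have "exp (- (S n * q n)) \<le> exp 2 * exp (- (S n * r n))"
        by (simp add: exp_add[symmetric])
      moreover have "1 - exp (- (a * q n)) \<le> 1 - exp (- (a * r n))"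
        using r a by (simp add: mult_left_mono)
      ultimately have "g n \<le> exp 2 * exp (- (S n * r n)) * (1 - exp (- (a * r n)))"
        unfolding g_def a_def[symmetric] using q a by (intro mult_mono) auto
      also have "\<dots> = exp 2 * f n" by (simp add: f_def a_def)
      finally show ?thesis using g0 frac0 by simp
    next
      case False
      define W where "W = S n * q n"
      have W: "4 \<le> W" using q by (simp add: W_def)
      have "S n \<le> W\<^sup>2"
      proof -
        have "S n * 1 \<le> S n * (S n * (q n)\<^sup>2)" using False S by (intro mult_left_mono) auto
        then show ?thesis by (simp add: W_def power2_eq_square algebra_simps)
      qed
      have "1 - exp (- (a * q n)) \<le> min 1 (a / S n) * W"
      proof (cases "a / S n \<le> 1")
        case True
        have "1 - exp (- (a * q n)) \<le> a * q n"
          using exp_ge_add_one_self[of "- (a * q n)"] by simp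
        also have "\<dots> = a / S n * W" using S by (simp add: W_def)
        finally show ?thesis unfolding min_absorb2[OF True] .
      next
        case False
        have "1 - exp (- (a * q n)) \<le> 1" by simp
        also have "1 \<le> W" using W by simp
        finally show ?thesis using False by (simp add: min_def)
      qed
      then have "g n \<le> exp (- W) * (min 1 (a / S n) * W)"
        unfolding g_def W_def[symmetric] a_def[symmetric] by (intro mult_left_mono) auto
      \<comment> \<open>Squaring the quadratic bound gives a decay of order \<open>1 / W ^ 4\<close>, which absorbs the factor \<open>W\<close>
        and still leaves \<open>1 / W\<^sup>2 \<le> 1 / S n\<close>.\<close>
      also have "\<dots> = (exp (- (W / 2)))\<^sup>2 * W * min 1 (a / S n)"
        by (simp add: power2_eq_square exp_add[symmetric])
      also have "\<dots> \<le> (2 / (W / 2)\<^sup>2)\<^sup>2 * W * min 1 (a / S n)"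
        using W S a exp_minus_le_inverse_square[of "W / 2"]
        by (intro mult_right_mono power_mono) auto
      also have "\<dots> = 64 / W ^ 2 * (1 / W) * min 1 (a / S n)"
        using W by (simp add: power2_eq_square field_simps)
      also have "\<dots> \<le> 64 / S n * 1 * min 1 (a / S n)"
        using W S a \<open>S n \<le> W\<^sup>2\<close> by (intro mult_mono divide_left_mono) auto
      also have "\<dots> = 64 * (min 1 ((S (Suc n) - S n) / S n) / S n)" by (simp add: a_def)
      also have "\<dots> \<le> 64 * (2 * (1 / S n - 1 / S (Suc n)))"
        using S by (intro mult_left_mono relative_increment_le_telescope) auto
      finally show ?thesis using g0 f0 by (simp add: add_increasing)
    qed
  qed
  ultimately have "summable g"
    by (rule summable_comparison_test'[where N = 0])
  then have "summable (\<lambda>n. exp (- (s (n + N0) * tail_seq F l (n + N0)))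
      * (1 - exp (- (\<alpha> (n + N0 + 1) * tail_seq F l (n + N0)))))"
    by (simp add: g_def S_def q_def s_Suc)
  then show False
    using K summable_iff_shift[of "\<lambda>n. exp (- (s n * tail_seq F l n)) * (1 - exp (- (\<alpha> (n + 1) * tail_seq F l n)))" N0]
    by simp
qed

text \<open>
  Along the subsequence of separated peaks, the events that the maximum is at most the level have a
  divergent series of probabilities and bounded correlations. By the Kochen--Stone bound they recur
  with positive probability, and the zero-one law finishes the argument.
\<close>
lemma prob_ev_above_eq_0_if_not_summable:
  assumes s: "filterlim s at_top sequentially"
    and l: "mono_on {1..} l" and q: "tail_seq F l \<longlonglongrightarrow> 0"
    and sq: "filterlim (\<lambda>n. s n * tail_seq F l n) at_top sequentially"
    and K: "\<not> summable (\<lambda>n. exp (- (s n * tail_seq F l n)) * (1 - exp (- (\<alpha> (n + 1) * tail_seq F l n))))"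
  shows "prob (ev_above P X l) = 0"
proof -
  have "\<forall>\<^sub>F n in sequentially. tail_seq F l n < 1 / 2" using q by (rule order_tendstoD) simp
  moreover have "\<forall>\<^sub>F n in sequentially. 4 \<le> s n * tail_seq F l n"
    using sq by (simp add: filterlim_at_top)
  moreover have "\<forall>\<^sub>F n in sequentially. 1 \<le> n" by (rule eventually_ge_at_top)
  ultimately have "\<forall>\<^sub>F n in sequentially. tail_seq F l n \<le> 1 / 2 \<and> 4 \<le> s n * tail_seq F l n \<and> 1 \<le> n"
    by eventually_elim simp
  then obtain N0 where N0: "1 \<le> N0" "\<And>n. N0 \<le> n \<Longrightarrow> tail_seq F l n \<le> 1 / 2"
      "\<And>n. N0 \<le> n \<Longrightarrow> 4 \<le> s n * tail_seq F l n"
    by (auto simp: eventually_sequentially)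
  define S where "S = (\<lambda>n. s (n + N0))"
  define r where "r = (\<lambda>n. - ln (F (l (n + N0))))"
  have F_pos: "0 < F (l (n + N0))" for n
    using N0(2)[of "n + N0"] by (simp add: tail_seq_def)
  have l_le: "l (i + N0) \<le> l (j + N0)" if "i \<le> j" for i j
    using mono_onD[OF l, of "i + N0" "j + N0"] that N0(1) by simp
  have S_pos: "0 < S n" for n using s_pos[of "n + N0"] N0(1) by (simp add: S_def)
  have large: "4 \<le> S n * r n" for n
  proof -
    have "tail_seq F l (n + N0) \<le> r n"
      using minus_ln_one_minus_bounds(1)[OF tail_seq_nonneg N0(2)[of "n + N0"]]
      by (simp add: r_def tail_seq_def)
    then have "S n * tail_seq F l (n + N0) \<le> S n * r n"
      using S_pos[of n] by (intro mult_left_mono) auto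
    then show ?thesis using N0(3)[of "n + N0"] by (simp add: S_def)
  qed
  have r_pos: "0 < r n" for n
    using large[of n] S_pos[of n] by (smt (verit) mult_nonneg_nonpos)
  obtain m G where m: "strict_mono m"
    and G: "\<not> summable (\<lambda>k. if k \<in> G then exp (- (S (m k) * r (m k))) else 0)"
    and corr: "\<And>k J N. \<lbrakk>k \<in> G; J \<subseteq> {k<..N}\<rbrakk> \<Longrightarrow>
      (\<Sum>j\<in>J. exp (- ((S (m j) - S (m k)) * r (m j))))
        \<le> (1 / (1 - exp (- 1 / 8)) + 200) + exp 1 * (\<Sum>j\<in>J. exp (- (S (m j) * r (m j))))"
  proof (rule divergent_subsequence_with_bounded_correlation[of S r])
    show "\<not> summable (\<lambda>n. (1 - exp (- ((S (Suc n) - S n) * r n))) * exp (- (S n * r n)))"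
      using recurrence_series_diverges[OF s N0 K] by (simp add: S_def r_def)
    show "r j \<le> r i" if "i \<le> j" for i j
      using F_mono[OF l_le[OF that]] F_pos by (simp add: r_def)
  qed (use S_pos r_pos large s_mono in \<open>auto simp: S_def\<close>)
  define B where "B = (\<lambda>n. max_le (l (n + N0)) (n + N0))"
  define A where "A = (\<lambda>k. if k \<in> G then B (m k) else {})"
  have prob_B: "prob (B n) = exp (- (S n * r n))" for n
    using prob_max_le_eq_exp[of "n + N0" l] N0(1,2) by (simp add: B_def S_def r_def)
  have prob_A: "prob (A k) = (if k \<in> G then exp (- (S (m k) * r (m k))) else 0)" for k
    by (simp add: A_def prob_B)
  have prob_A_Int: "prob (A k \<inter> A j) = prob (A k) * exp (- ((S (m j) - S (m k)) * r (m j)))"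
    if "k < j" "k \<in> G" "j \<in> G" for k j
  proof -
    have "m k < m j" using m that by (simp add: strict_mono_less)
    then show ?thesis
      using prob_max_le_Int_eq_exp[of "m k + N0" "m j + N0" l] that N0(1) F_pos l_le[of "m k" "m j"]
      by (simp add: A_def prob_B) (simp add: B_def S_def r_def)
  qed
  have recurrent: "1 / (1 + 2 * exp 1) \<le> prob (\<Union>k\<in>{K..}. A k)" for K
  proof (rule prob_tail_Union_ge_kochen_stone[where c = "1 / (1 - exp (- 1 / 8)) + 200"])
    show "A k \<in> events" for k by (simp add: A_def B_def)
    show "\<not> summable (\<lambda>k. prob (A k))" using G by (simp add: prob_A)
    show "(\<Sum>j\<in>{k<..<N}. prob (A k \<inter> A j))
      \<le> prob (A k) * (1 / (1 - exp (- 1 / 8)) + 200 + exp 1 * (\<Sum>j\<in>{k<..<N}. prob (A j)))" for k N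
    proof (cases "k \<in> G")
      case True
      define J where "J = {k<..<N} \<inter> G"
      have "(\<Sum>j\<in>{k<..<N}. prob (A k \<inter> A j)) = (\<Sum>j\<in>J. prob (A k \<inter> A j))"
        unfolding J_def by (intro sum.mono_neutral_right) (auto simp: A_def)
      also have "\<dots> = prob (A k) * (\<Sum>j\<in>J. exp (- ((S (m j) - S (m k)) * r (m j))))"
        unfolding sum_distrib_left using True by (intro sum.cong prob_A_Int) (auto simp: J_def)
      also have "\<dots> \<le> prob (A k) * (1 / (1 - exp (- 1 / 8)) + 200 + exp 1 * (\<Sum>j\<in>J. exp (- (S (m j) * r (m j)))))"
        using True by (intro mult_left_mono corr[of _ _ N]) (auto simp: J_def)
      also have "(\<Sum>j\<in>J. exp (- (S (m j) * r (m j)))) = (\<Sum>j\<in>{k<..<N}. prob (A j))"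
        unfolding J_def by (intro sum.mono_neutral_cong_left) (auto simp: prob_A)
      finally show ?thesis .
    next
      case False
      then show ?thesis by (simp add: A_def)
    qed
  qed auto
  show ?thesis
  proof (rule prob_ev_above_eq_0_if_recurrent[OF l q])
    show "0 < 1 / (1 + 2 * exp 1 :: real)" by (simp add: add_pos_pos)
    fix K
    have "(\<Union>k\<in>{K..}. A k) \<subseteq> (\<Union>n\<in>{K..}. max_le (l n) n)"
    proof
      fix \<omega> assume "\<omega> \<in> (\<Union>k\<in>{K..}. A k)"
      then obtain k where k: "K \<le> k" "\<omega> \<in> B (m k)" by (auto simp: A_def split: if_splits)
      moreover have "k \<le> m k" using m by (rule strict_mono_imp_increasing)
      ultimately show "\<omega> \<in> (\<Union>n\<in>{K..}. max_le (l n) n)"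
        unfolding B_def by (intro UN_I[of "m k + N0"]) auto
    qed
    then have "prob (\<Union>k\<in>{K..}. A k) \<le> prob (\<Union>n\<in>{K..}. max_le (l n) n)"
      by (intro finite_measure_mono sets.countable_UN'') auto
    then show "1 / (1 + 2 * exp 1) \<le> prob (\<Union>n\<in>{K..}. max_le (l n) n)"
      using recurrent[of K] by linarith
  qed
qed

end

section \<open>The criterion\<close>

theorem corollary2:
  fixes D :: "real measure" and F :: "real \<Rightarrow> real"
    and \<alpha> l s q :: "nat \<Rightarrow> real"
    and P :: "'a measure" and X :: "nat \<Rightarrow> 'a \<Rightarrow> real"
  assumes "real_distribution D" and "F = cdf D" and "continuous_on UNIV F"
    and "\<And>n. n \<ge> 1 \<Longrightarrow> \<alpha> n > 0"
    and "s = partial_sum \<alpha>"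
    and "filterlim s at_top sequentially"
    and "prob_space P"
    and "prob_space.indep_vars P (\<lambda>_. borel) X {1..}"
    and "\<And>n x. n \<ge> 1 \<Longrightarrow> cdf (distr P borel (X n)) x = F x powr \<alpha> n"
    and "mono_on {1..} l"
    and "q = tail_seq F l"
  shows "(measure P (ev_above P X l) = 0 \<or> measure P (ev_above P X l) = 1)
    \<and> (\<forall>c>0. q \<longlonglongrightarrow> c \<longrightarrow> measure P (ev_above P X l) = 1)
    \<and> (q \<longlonglongrightarrow> 0 \<and> liminf (\<lambda>n. ereal (s n * q n)) < \<infinity>
         \<longrightarrow> measure P (ev_above P X l) = 0)
    \<and> (q \<longlonglongrightarrow> 0 \<and> filterlim (\<lambda>n. s n * q n) at_top sequentially
         \<longrightarrow> (K_series \<alpha> q = \<infinity> \<longrightarrow> measure P (ev_above P X l) = 0)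
           \<and> (K_series \<alpha> q < \<infinity> \<longrightarrow> measure P (ev_above P X l) = 1))"
proof -
  interpret D: real_distribution D by fact
  interpret maxima_of_cdf_powers P X F \<alpha>
  proof -
    interpret prob_space P by fact
    show "maxima_of_cdf_powers P X F \<alpha>"
      using assms by unfold_locales (auto simp: D.cdf_nonneg D.cdf_bounded_prob D.cdf_nondecreasing)
  qed
  have q_antimono: "q n \<le> q m" if "1 \<le> m" "m \<le> n" for m n
    using F_mono[of "l m" "l n"] mono_onD[OF assms(10), of m n] that by (simp add: assms(11) tail_seq_def)
  have q_nonneg: "0 \<le> q n" for n using tail_seq_nonneg[of l n] assms(11) by simp
  \<comment> \<open>A level \<open>L\<close> with \<open>F L = 1 - c / 2\<close> exists by continuity and dominates all \<open>l n\<close>, since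
    \<open>F (l n) \<le> 1 - c\<close>.\<close>
  have positive_limit: "prob (ev_above P X l) = 1" if c: "0 < c" "q \<longlonglongrightarrow> c" for c
  proof -
    have q_ge: "c \<le> q n" if "1 \<le> n" for n
      using that q_antimono[of n] by (intro LIMSEQ_le_const2[OF c(2)]) blast
    have c1: "c \<le> 1" using q_ge[of 1] F_nonneg[of "l 1"] by (simp add: assms(11) tail_seq_def)
    have "\<forall>\<^sub>F x in at_top. 1 - c / 2 < F x"
      using D.cdf_lim_at_top_prob c(1) unfolding assms(2) by (intro order_tendstoD(1)[of _ 1]) auto
    then obtain y where y: "l 1 \<le> y" "1 - c / 2 < F y"
      by (metis (no_types, lifting) eventually_at_top_linorder linear order_refl)
    have "F (l 1) \<le> 1 - c / 2" using q_ge[of 1] c(1) by (simp add: assms(11) tail_seq_def)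
    then obtain L where L: "F L = 1 - c / 2"
      using IVT'[of F "l 1" "1 - c / 2" y] y continuous_on_subset[OF assms(3)] by auto
    have "l n \<le> L" if "1 \<le> n" for n
    proof (rule ccontr)
      assume "\<not> l n \<le> L"
      then have "F L \<le> F (l n)" by (intro F_mono) simp
      then show False using q_ge[OF that] L c(1) by (simp add: assms(11) tail_seq_def)
    qed
    then show ?thesis
      using L c(1) assms(5,6) by (intro prob_ev_above_eq_1_if_bounded[of L]) auto
  qed
  \<comment> \<open>\<open>q\<close> is non-increasing, so it has a limit \<open>c\<close>; if \<open>c > 0\<close> the probability is \<open>1\<close>, and if
    \<open>c = 0\<close> Kolmogorov's law applies.\<close>
  have zero_one: "prob (ev_above P X l) = 0 \<or> prob (ev_above P X l) = 1"
  proof -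
    have "decseq (\<lambda>n. q (Suc n))" using q_antimono by (auto simp: decseq_def)
    then obtain c where "(\<lambda>n. q (Suc n)) \<longlonglongrightarrow> c" "0 \<le> c"
      using decseq_convergent[of "\<lambda>n. q (Suc n)" 0] q_nonneg LIMSEQ_le_const by metis
    then have "q \<longlonglongrightarrow> c" by (simp add: filterlim_sequentially_Suc)
    then show ?thesis
      using positive_limit[of c] \<open>0 \<le> c\<close> ev_above_zero_one[OF assms(10) tendsto_F_if_tail_seq] assms(11)
      by (cases "c = 0") auto
  qed
  have frequently_bounded: "prob (ev_above P X l) = 0"
    if "q \<longlonglongrightarrow> 0" and liminf: "liminf (\<lambda>n. ereal (s n * q n)) < \<infinity>"
  proof -
    obtain B where "liminf (\<lambda>n. ereal (s n * q n)) < ereal B"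
      using liminf less_PInf_Ex_of_nat by fastforce
    then have "\<exists>\<^sub>F n in sequentially. ereal (s n * q n) < ereal B"
      using Liminf_bounded[of "ereal B" "\<lambda>n. ereal (s n * q n)" sequentially]
      by (auto simp: frequently_def not_less)
    then show ?thesis
      using that(1) assms(5,10,11) by (intro prob_ev_above_eq_0_if_frequently_bounded[of l B]) auto
  qed
  have "prob (ev_above P X l) = 0"
    if "q \<longlonglongrightarrow> 0" "filterlim (\<lambda>n. s n * q n) at_top sequentially" "K_series \<alpha> q = \<infinity>"
    using that assms not_summable_if_K_series_infinite[OF that(3)] q_nonneg
    by (intro prob_ev_above_eq_0_if_not_summable) auto
  moreover have "prob (ev_above P X l) = 1"
    if "q \<longlonglongrightarrow> 0" "filterlim (\<lambda>n. s n * q n) at_top sequentially" "K_series \<alpha> q < \<infinity>"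
    using that assms summable_if_K_series_finite[OF that(3)] q_nonneg
    by (intro prob_ev_above_eq_1_if_summable) auto
  ultimately show ?thesis
    using zero_one positive_limit frequently_bounded by blast
qed

end
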